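(* Let $1\le p,q\le\infty$ with $\frac1p+\frac1q=1$, and let $\mathcal P$ be a digital net over $\mathbb{F}_2$ with $2^m$ points in $[0,1)^s$ ($m,s\in\mathbb{N}$) obtained from a Sobol' sequence. Let $c>0$ be the constant in the bound on the quality parameters of Sobol' nets (specified in the context). (i) Assume there exists a $\delta\in(0,1)$ such that $$C_{\mathrm{Sob}}(\delta,\boldsymbol\gamma,q):=\sup_{s\in\mathbb{N}}\left(\sum_{\emptyset\ne\mathfrak u\subseteq[s]}\left(\gamma_{\mathfrak u}\prod_{i\in\mathfrak u}\left[\frac{2^{c+1}\,|\mathfrak u|\,i}{\mathrm e\,\delta\ln2}\,\mathrm{ld}(i+1)\,\mathrm{ld}\,\mathrm{ld}(i+3)\,(b_i-a_i)\right]\right)^q\right)^{1/q}<\infty$$ (with the $\ell_q$-sum replaced by a maximum over $\mathfrak u$ if $q=\infty$). Then $$\mathrm{wce}(\mathcal P;p,s,\boldsymbol\gamma,\varphi)\le\frac{3\,C_{\mathrm{Sob}}(\delta,\boldsymbol\gamma,q)}{2^{m(1-\delta)}}.$$ (ii) For strictly positive weights, if $$S_{\mathrm{Sob}}(\boldsymbol\gamma):=\sum_{i=1}^\infty[i\,\mathrm{ld}(i+1)\,\mathrm{ld}\,\mathrm{ld}(i+3)\,(b_i-a_i)]\max_{\mathfrak v\subseteq[i-1]}\frac{\gamma_{\mathfrak v\cup\{i\}}}{\gamma_{\mathfrak v}}<\infty,$$ where in this expression $\gamma_\emptyset:=1$, then for any $\delta\in\left(0,\min\left\{1,\frac{2^{c+2}S_{\mathrm{Sob}}(\boldsymbol\gamma)}{\ln2}\right\}\right)$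 we have $$\mathrm{wce}(\mathcal P;p,s,\boldsymbol\gamma,\varphi)\le\frac{C_{\mathrm{Sob,prod}}(\delta,\boldsymbol\gamma)}{2^{m(1-\delta)}},\qquad C_{\mathrm{Sob,prod}}(\delta,\boldsymbol\gamma)=3\left(\frac{2^{c+2}S_{\mathrm{Sob}}(\boldsymbol\gamma)}{\delta\ln2}\right)^b,$$ where the integer $b\ge0$ is such that $$\sum_{i=b+1}^\infty[i\,\mathrm{ld}(i+1)\,\mathrm{ld}\,\mathrm{ld}(i+3)\,(b_i-a_i)]\max_{\mathfrak v\subseteq[i-1]}\frac{\gamma_{\mathfrak v\cup\{i\}}}{\gamma_{\mathfrak v}}<\frac{\delta\ln2}{2^{c+2}}$$ (again with $\gamma_\emptyset:=1$).
   Context: Notation: $\mathrm{ld}$ is the logarithm in base $2$, $\ln$ the natural logarithm, $\mathrm e$ Euler's number, $[s]=\{1,\ldots,s\}$, $[0]=\emptyset$. Setting. There are given sequences of reals $-\infty<a_i<b_i<\infty$, $i\in\mathbb{N}$, probability density functions $\varphi_i:[a_i,b_i]\to\mathbb{R}$ (with respect to Lebesgue measure) whose distribution functions $\Phi_i(x)=\int_{a_i}^x\varphi_i(y)\,\mathrm dy$ are invertible as maps $[a_i,b_i]\to[0,1]$, and positive weights $\boldsymbol\gamma=\{\gamma_{\mathfrak u}\}$ indexed by the finite sets $\mathfrak u\subset\mathbb{N}$. In dimension $s$: $[\boldsymbol a,\boldsymbol b]=\prod_{i=1}^s[a_i,b_i]$, $\varphi(\boldsymbol x)=\prod_{i=1}^s\varphi_i(x_i)$,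 $\Phi^{-1}(\boldsymbol x)=(\Phi_1^{-1}(x_1),\ldots,\Phi_s^{-1}(x_s))$. Norm. For $\mathfrak u=\{u_1<\cdots<u_k\}\subseteq[s]$ let $\frac{\partial^{|\mathfrak u|}F}{\partial\boldsymbol x_{\mathfrak u}}=\frac{\partial^kF}{\partial x_{u_1}\cdots\partial x_{u_k}}$ (equal to $F$ for $\mathfrak u=\emptyset$). For functions $F:[\boldsymbol a,\boldsymbol b]\to\mathbb{R}$ for which these mixed partial derivatives exist, $\|F\|_{p,s,\boldsymbol\gamma}=\left(\sum_{\mathfrak u\subseteq[s]}\left(\frac1{\gamma_{\mathfrak u}}\sup_{\boldsymbol x\in[\boldsymbol a,\boldsymbol b]}\left|\frac{\partial^{|\mathfrak u|}F}{\partial\boldsymbol x_{\mathfrak u}}(\boldsymbol x)\right|\right)^p\right)^{1/p}$, with the maximum over $\mathfrak u$ if $p=\infty$. Worst-case error. For points $\mathcal P=\{\boldsymbol y_0,\ldots,\boldsymbol y_{N-1}\}$ in $[0,1]^s$, $\mathrm{wce}(\mathcal P;p,s,\boldsymbol\gamma,\varphi)=\sup_{\|F\|_{p,s,\boldsymbol\gamma}\le1}\left|\frac1N\sum_{n=0}^{N-1}F(\Phi^{-1}(\boldsymbol y_n))-\int_{[\boldsymbol a,\boldsymbol b]}F(\boldsymbol x)\varphi(\boldsymbol x)\,\mathrm d\boldsymbol x\right|$. Digital nets. Given $m\times m$ matrices $A_1,\ldots,A_s$ over $\mathbb{F}_2=\{0,1\}$ (generating matrices), the digital net generated by them consists of the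 points $\boldsymbol x_n=(x_n^{(1)},\ldots,x_n^{(s)})$, $0\le n<2^m$, where for $n=n_0+n_12+\cdots+n_{m-1}2^{m-1}$, $\vec n=(n_0,\ldots,n_{m-1})^\top$ and $A_i\vec n=(y_1^{(i)},\ldots,y_m^{(i)})^\top$ over $\mathbb{F}_2$ one sets $x_n^{(i)}=\sum_{k=1}^my_k^{(i)}2^{-k}$. Matrices $(A_i)_{i\in\mathfrak u}$ generate a digital $(t,m,|\mathfrak u|)$-net ($0\le t\le m$) if for all non-negative integers $(d_i)_{i\in\mathfrak u}$ with $\sum_{i\in\mathfrak u}d_i=m-t$ the system consisting of the first $d_i$ rows of $A_i$, $i\in\mathfrak u$, is linearly independent over $\mathbb{F}_2$. Sobol' sequence. $C_1\in\mathbb{F}_2^{\mathbb{N}\times\mathbb{N}}$ is the identity matrix. Let $p_2,p_3,\ldots$ be the distinct primitive polynomials over $\mathbb{F}_2$ (starting with $x+1$) in order of non-decreasing degree. For $i\ge2$ write $p_i=x^{e}+\alpha_1x^{e-1}+\cdots+\alpha_{e-1}x+1$ with $e=\deg p_i$, choose odd integers $\mu_{i,k}$ with $1\le\mu_{i,k}<2^k$ for $1\le k\le e$, and for $k>e$ define $\mu_{i,k}=2\alpha_1\mu_{i,k-1}\oplus2^2\alpha_2\mu_{i,k-2}\oplus\cdots\oplus2^{e-1}\alpha_{e-1}\mu_{i,k-e+1}\oplus2^e\mu_{i,k-e}\oplus\mu_{i,k-e}$, where $\oplus$ is bitwise addition modulo 2. The $k$-th column of $C_i$ consists of the binary digits $(v_1,v_2,\ldots)^\top$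 of $\mu_{i,k}/2^k=\sum_{l\ge1}v_l2^{-l}$ (so $C_i$ is non-singular upper triangular). A digital net with $2^m$ points in $[0,1)^s$ obtained from a Sobol' sequence is the digital net generated by the upper left $m\times m$ submatrices of $C_1,\ldots,C_s$. The constant $c$. $c>0$ is a constant, independent of $i$, $\mathfrak u$, $s$ (and $m$), such that for every non-empty finite $\mathfrak u\subset\mathbb{N}$ and every $m$ the smallest $t_{\mathfrak u}$ for which the upper left $m\times m$ submatrices of $(C_i)_{i\in\mathfrak u}$ generate a digital $(t_{\mathfrak u},m,|\mathfrak u|)$-net satisfies $t_{\mathfrak u}\le\sum_{i\in\mathfrak u}\left(\mathrm{ld}(i)+\mathrm{ld}\,\mathrm{ld}(i+1)+\mathrm{ld}\,\mathrm{ld}\,\mathrm{ld}(i+3)+c\right)$; such a constant is known to exist. *)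

theory Defs
  imports
    "HOL-Analysis.Analysis"
    "HOL-Computational_Algebra.Computational_Algebra"
    "HOL-Library.Z2"
begin

abbreviation ld :: "real \<Rightarrow> real"
  where "ld \<equiv> log 2"

text \<open>
  Coordinates are numbered from 1.  Points of \<open>\<real>\<^sup>s\<close> are the functions in
  \<open>\<Pi>\<^sub>E i\<in>{1..s}. UNIV\<close>; a function \<open>F\<close> on the box \<open>[a,b]\<close> is a total function of which only
  the values on \<open>coord_box s a b\<close> matter.
\<close>

definition coord_box :: "nat \<Rightarrow> (nat \<Rightarrow> real) \<Rightarrow> (nat \<Rightarrow> real) \<Rightarrow> (nat \<Rightarrow> real) set"
  where "coord_box s a b = (\<Pi>\<^sub>E i\<in>{1..s}. {a i..b i})"


subsection \<open>Densities and distribution functions\<close>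

definition prob_density_on :: "real \<Rightarrow> real \<Rightarrow> (real \<Rightarrow> real) \<Rightarrow> bool"
  where "prob_density_on l u f \<longleftrightarrow>
    (\<forall>x\<in>{l..u}. 0 \<le> f x) \<and> set_integrable lebesgue {l..u} f \<and>
    (LINT x:{l..u}|lebesgue. f x) = 1"

definition distr_fun :: "real \<Rightarrow> (real \<Rightarrow> real) \<Rightarrow> real \<Rightarrow> real"
  where "distr_fun l f x = (LINT y:{l..x}|lebesgue. f y)"

definition prod_density :: "nat \<Rightarrow> (nat \<Rightarrow> real \<Rightarrow> real) \<Rightarrow> (nat \<Rightarrow> real) \<Rightarrow> real"
  where "prod_density s \<phi> x = (\<Prod>i=1..s. \<phi> i (x i))"

definition inv_distr ::
    "nat \<Rightarrow> (nat \<Rightarrow> real) \<Rightarrow> (nat \<Rightarrow> real) \<Rightarrow> (nat \<Rightarrow> real \<Rightarrow> real) \<Rightarrow> (nat \<Rightarrow> real) \<Rightarrow> (nat \<Rightarrow> real)"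
  where "inv_distr s a b \<phi> x =
    (\<lambda>i\<in>{1..s}. the_inv_into {a i..b i} (distr_fun (a i) (\<phi> i)) (x i))"


subsection \<open>The weighted norm\<close>

text \<open>The derivatives are taken within \<open>[a\<^sub>i,b\<^sub>i]\<close>, hence one-sided on the boundary of the box.\<close>

definition partial_deriv ::
    "(nat \<Rightarrow> real) \<Rightarrow> (nat \<Rightarrow> real) \<Rightarrow> nat \<Rightarrow> ((nat \<Rightarrow> real) \<Rightarrow> real) \<Rightarrow> (nat \<Rightarrow> real) \<Rightarrow> real"
  where "partial_deriv a b i F x =
    vector_derivative (\<lambda>t. F (x(i := t))) (at (x i) within {a i..b i})"

text \<open>For \<open>u = {u\<^sub>1 < \<dots> < u\<^sub>k}\<close> the derivative with respect to \<open>x\<^bsub>u\<^sub>k\<^esub>\<close> is taken first.\<close>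

definition mixed_deriv ::
    "(nat \<Rightarrow> real) \<Rightarrow> (nat \<Rightarrow> real) \<Rightarrow> nat set \<Rightarrow> ((nat \<Rightarrow> real) \<Rightarrow> real) \<Rightarrow> (nat \<Rightarrow> real) \<Rightarrow> real"
  where "mixed_deriv a b u F = foldr (partial_deriv a b) (sorted_list_of_set u) F"

definition mixed_derivs_exist ::
    "nat \<Rightarrow> (nat \<Rightarrow> real) \<Rightarrow> (nat \<Rightarrow> real) \<Rightarrow> ((nat \<Rightarrow> real) \<Rightarrow> real) \<Rightarrow> bool"
  where "mixed_derivs_exist s a b F \<longleftrightarrow>
    (\<forall>u i. u \<subseteq> {1..s} \<and> i \<in> {1..s} \<and> (\<forall>j\<in>u. i < j) \<longrightarrow>
      (\<forall>x\<in>coord_box s a b.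
        (\<lambda>t. mixed_deriv a b u F (x(i := t))) differentiable (at (x i) within {a i..b i})))"

text \<open>The \<open>\<ell>\<^sub>p\<close>-norm of a finite non-empty family of non-negative numbers.\<close>

definition lp_sum :: "ereal \<Rightarrow> 'a set \<Rightarrow> ('a \<Rightarrow> real) \<Rightarrow> real"
  where "lp_sum p A f =
    (if p = \<infinity> then Max (f ` A)
     else (\<Sum>u\<in>A. f u powr real_of_ereal p) powr (1 / real_of_ereal p))"

definition weighted_norm ::
    "ereal \<Rightarrow> nat \<Rightarrow> (nat set \<Rightarrow> real) \<Rightarrow> (nat \<Rightarrow> real) \<Rightarrow> (nat \<Rightarrow> real) \<Rightarrow> ((nat \<Rightarrow> real) \<Rightarrow> real) \<Rightarrow> ereal"
  where "weighted_norm p s \<gamma> a b F =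
    (if \<forall>u\<subseteq>{1..s}. bdd_above ((\<lambda>x. \<bar>mixed_deriv a b u F x\<bar>) ` coord_box s a b)
     then ereal (lp_sum p (Pow {1..s})
            (\<lambda>u. 1 / \<gamma> u * (SUP x\<in>coord_box s a b. \<bar>mixed_deriv a b u F x\<bar>)))
     else \<infinity>)"


subsection \<open>The worst-case error\<close>

definition wce ::
    "nat \<Rightarrow> (nat \<Rightarrow> nat \<Rightarrow> real) \<Rightarrow> ereal \<Rightarrow> nat \<Rightarrow> (nat set \<Rightarrow> real) \<Rightarrow>
     (nat \<Rightarrow> real) \<Rightarrow> (nat \<Rightarrow> real) \<Rightarrow> (nat \<Rightarrow> real \<Rightarrow> real) \<Rightarrow> ereal"
  where "wce N y p s \<gamma> a b \<phi> =
    (SUP F \<in> {F. mixed_derivs_exist s a b F \<and> weighted_norm p s \<gamma> a b F \<le> 1}.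
      ereal \<bar>1 / real N * (\<Sum>n<N. F (inv_distr s a b \<phi> (y n)))
        - (LINT x:coord_box s a b|PiM {1..s} (\<lambda>_. lebesgue). F x * prod_density s \<phi> x)\<bar>)"


subsection \<open>Digital nets over the field with two elements\<close>

text \<open>
  A matrix over \<open>GF(2)\<close> (possibly infinite) is a function of a row and a column index, both starting
  at 1.  Of an \<open>m \<times> m\<close> matrix only the entries with indices in \<open>{1..m}\<close> are used, so an infinite
  matrix also represents its upper left \<open>m \<times> m\<close> submatrix.
\<close>

definition digital_net :: "nat \<Rightarrow> nat \<Rightarrow> (nat \<Rightarrow> nat \<Rightarrow> nat \<Rightarrow> bit) \<Rightarrow> nat \<Rightarrow> (nat \<Rightarrow> real)"
  where "digital_net m s A n =
    (\<lambda>i\<in>{1..s}. \<Sum>k=1..m.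
       of_bool ((\<Sum>l=1..m. A i k l * of_bool (bit n (l - 1))) = 1) / 2 ^ k)"

text \<open>Independence of the system (not the set) formed by the first \<open>d i\<close> rows of each \<open>A i\<close>.\<close>

definition rows_independent ::
    "nat set \<Rightarrow> nat \<Rightarrow> (nat \<Rightarrow> nat) \<Rightarrow> (nat \<Rightarrow> nat \<Rightarrow> nat \<Rightarrow> bit) \<Rightarrow> bool"
  where "rows_independent u m d A \<longleftrightarrow>
    (\<forall>h. (\<forall>l\<in>{1..m}. (\<Sum>i\<in>u. \<Sum>k=1..d i. h i k * A i k l) = 0) \<longrightarrow>
         (\<forall>i\<in>u. \<forall>k\<in>{1..d i}. h i k = 0))"

definition generates_digital_net ::
    "nat \<Rightarrow> nat \<Rightarrow> nat set \<Rightarrow> (nat \<Rightarrow> nat \<Rightarrow> nat \<Rightarrow> bit) \<Rightarrow> bool"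
  where "generates_digital_net t m u A \<longleftrightarrow>
    t \<le> m \<and> (\<forall>d. (\<Sum>i\<in>u. d i) = m - t \<longrightarrow> rows_independent u m d A)"


subsection \<open>Sobol' sequences\<close>

text \<open>
  A polynomial over \<open>GF(2)\<close> is primitive if it is irreducible and its root, the residue class of the
  indeterminate, generates the multiplicative group of the residue field.  The root has to be
  non-zero, which excludes the polynomial \<open>x\<close>.
\<close>

definition primitive_poly :: "bit poly \<Rightarrow> bool"
  where "primitive_poly f \<longleftrightarrow>
    irreducible f \<and> \<not> f dvd [:0, 1:] \<and>
    (\<forall>g. \<not> f dvd g \<longrightarrow> (\<exists>k. [:0, 1:] ^ k mod f = g mod f))"

definition primitive_enumeration :: "(nat \<Rightarrow> bit poly) \<Rightarrow> bool"
  where "primitive_enumeration P \<longleftrightarrow>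
    bij_betw P {2..} {f. primitive_poly f} \<and>
    (\<forall>i j. 2 \<le> i \<and> i \<le> j \<longrightarrow> degree (P i) \<le> degree (P j))"

text \<open>
  The coefficient \<open>\<alpha>\<^sub>j\<close> of \<open>P i\<close> is its coefficient at \<open>x\<^bsup>e-j\<^esup>\<close>, where \<open>e\<close> is the degree.
\<close>

definition direction_numbers :: "(nat \<Rightarrow> bit poly) \<Rightarrow> (nat \<Rightarrow> nat \<Rightarrow> nat) \<Rightarrow> bool"
  where "direction_numbers P \<mu> \<longleftrightarrow>
    (\<forall>i\<ge>2. let e = degree (P i) in
      (\<forall>k\<in>{1..e}. odd (\<mu> i k) \<and> 1 \<le> \<mu> i k \<and> \<mu> i k < 2 ^ k) \<and>
      (\<forall>k>e. \<mu> i k =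
         foldr xor (map (\<lambda>j. 2 ^ j * of_bool (coeff (P i) (e - j) = 1) * \<mu> i (k - j)) [1..<e])
           (xor (2 ^ e * \<mu> i (k - e)) (\<mu> i (k - e)))))"

text \<open>
  For \<open>i \<ge> 2\<close> the entry in row \<open>l\<close> and column \<open>k\<close> is the \<open>l\<close>-th binary digit of
  \<open>\<mu> i k / 2^k \<in> [0,1)\<close>, taken from its finite expansion.
\<close>

definition sobol_matrix :: "(nat \<Rightarrow> nat \<Rightarrow> nat) \<Rightarrow> nat \<Rightarrow> nat \<Rightarrow> nat \<Rightarrow> bit"
  where "sobol_matrix \<mu> i l k =
    (if i = 1 then of_bool (l = k)
     else of_bool (odd \<lfloor>2 ^ l * (real (\<mu> i k) / 2 ^ k)\<rfloor>))"

definition sobol_quality_constant :: "(nat \<Rightarrow> nat \<Rightarrow> nat) \<Rightarrow> real \<Rightarrow> bool"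
  where "sobol_quality_constant \<mu> c \<longleftrightarrow>
    c > 0 \<and>
    (\<forall>u m. finite u \<and> u \<noteq> {} \<and> u \<subseteq> {1..} \<and> m \<ge> 1 \<longrightarrow>
      real (LEAST t. generates_digital_net t m u (sobol_matrix \<mu>))
        \<le> (\<Sum>i\<in>u. ld (real i) + ld (ld (real i + 1)) + ld (ld (ld (real i + 3))) + c))"


subsection \<open>The constants in the error bounds\<close>

definition C_Sob ::
    "real \<Rightarrow> real \<Rightarrow> (nat set \<Rightarrow> real) \<Rightarrow> ereal \<Rightarrow> (nat \<Rightarrow> real) \<Rightarrow> (nat \<Rightarrow> real) \<Rightarrow> ereal"
  where "C_Sob c \<delta> \<gamma> q a b =
    (SUP s\<in>{1::nat..}. ereal (lp_sum q (Pow {1..s} - {{}})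
       (\<lambda>u. \<gamma> u * (\<Prod>i\<in>u. 2 powr (c + 1) * real (card u) * real i / (exp 1 * \<delta> * ln 2)
              * ld (real i + 1) * ld (ld (real i + 3)) * (b i - a i)))))"

text \<open>The \<open>i\<close>-th summand of \<open>S_Sob\<close>; the empty set is given the weight 1 here.\<close>

definition S_Sob_term :: "(nat set \<Rightarrow> real) \<Rightarrow> (nat \<Rightarrow> real) \<Rightarrow> (nat \<Rightarrow> real) \<Rightarrow> nat \<Rightarrow> real"
  where "S_Sob_term \<gamma> a b i =
    real i * ld (real i + 1) * ld (ld (real i + 3)) * (b i - a i)
      * (MAX v\<in>Pow {1..<i}. (\<gamma>({} := 1)) (insert i v) / (\<gamma>({} := 1)) v)"

text \<open>The sum of the terms with index greater than \<open>B\<close>.\<close>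

definition S_Sob_tail :: "(nat set \<Rightarrow> real) \<Rightarrow> (nat \<Rightarrow> real) \<Rightarrow> (nat \<Rightarrow> real) \<Rightarrow> nat \<Rightarrow> real"
  where "S_Sob_tail \<gamma> a b B = (\<Sum>i. S_Sob_term \<gamma> a b (i + B + 1))"

definition S_Sob :: "(nat set \<Rightarrow> real) \<Rightarrow> (nat \<Rightarrow> real) \<Rightarrow> (nat \<Rightarrow> real) \<Rightarrow> real"
  where "S_Sob \<gamma> a b = (\<Sum>i. S_Sob_term \<gamma> a b (i + 1))"

definition C_Sob_prod ::
    "real \<Rightarrow> real \<Rightarrow> (nat set \<Rightarrow> real) \<Rightarrow> (nat \<Rightarrow> real) \<Rightarrow> (nat \<Rightarrow> real) \<Rightarrow> nat \<Rightarrow> real"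
  where "C_Sob_prod c \<delta> \<gamma> a b B = 3 * (2 powr (c + 2) * S_Sob \<gamma> a b / (\<delta> * ln 2)) ^ B"

end

theory Submission
  imports Defs
begin

text \<open>
  Partial summation on a fine grid of the box turns the quadrature error of \<open>F\<close> into a sum, over
  the non-empty \<open>u\<close>, of mixed differences of \<open>F\<close> in the directions \<open>u\<close> (each bounded by a mixed
  derivative through the mean value theorem) times local discrepancies of the projection of the net
  to \<open>u\<close>.  As only differences occur, no measurability of the mixed derivatives is needed, and the
  grid is refined by dominated convergence.

  For a digital \<open>(t, m, |u|)\<close>-net, cutting \<open>[0, z)\<close> along the binary digits of the \<open>z\<^sub>i\<close> yields at most
  \<open>(m + 1)\<^bsup>|u|\<^esup>\<close> elementary boxes, each with a local discrepancy of at most \<open>2\<^sup>t / 2\<^sup>m\<close>.  With the bound on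
  \<open>t\<^sub>u\<close> this gives the projected discrepancy \<open>3 / 2\<^sup>m * (\<Prod>i\<in>u. 2\<^bsup>c + 1\<^esup> m w\<^sub>i)\<close>, where
  \<open>w\<^sub>i = i ld(i + 1) ld ld(i + 3)\<close>.  Part (i) then follows from Hoelder's inequality and the maximum of
  \<open>m\<^bsup>|u|\<^esup> 2\<^bsup>-\<delta> m\<^esup>\<close>, part (ii) by factorising the sum over \<open>u\<close> into a product over the coordinates.
\<close>

subsection \<open>Digital nets\<close>

text \<open>The derivatives of \<open>F\<close> are only known to exist pointwise, in one order of
  differentiation, and to be bounded; the mean value theorem asks for no more than that. With
  \<open>K\<close> grid steps in each direction there are K^|u| mixed differences in the directions
  \<open>u\<close>, each of size O(K^-|u|). The powers of \<open>K\<close> cancel, which is why the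
  estimate survives refinement.

  An elementary box may be too fine for the net to hit it fairly. The error 2^t / 2^m still holds
  for it, because both its share of the points and its volume are then at most 2^t / 2^m.

  Origin of the constants: m + 1 <= 2 m puts a factor 2 m on each coordinate and turns 2^c into
  2^(c+1); rounding \<open>z\<close> to multiples of 2^-m adds at most |u| / 2^m, and 3 covers both
  errors. The factor e \<delta> ln 2 comes from maximising x^k exp(-r x) at the rate r = \<delta> ln
  2. In part (ii) the exponent \<delta> ln 2 is shared equally between an initial block of
  coordinates and the tail, hence 2^(c+2).\<close>

definition bit_char :: "bit \<Rightarrow> real"
  where "bit_char x = (if x = 0 then 1 else -1)"

lemma bit_char_simps [simp]: "bit_char 0 = 1" "bit_char 1 = -1"
  by (simp_all add: bit_char_def)

lemma bit_char_add: "bit_char (x + y) = bit_char x * bit_char y"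
  by (cases x; cases y) auto

lemma bit_char_sum: "bit_char (\<Sum>i\<in>A. f i) = (\<Prod>i\<in>A. bit_char (f i))"
  by (induction A rule: infinite_finite_induct) (auto simp: bit_char_add simp del: add_bit_eq_xor)

lemma one_plus_bit_char: "1 + bit_char (x + y) = (if x = y then 2 else 0)"
  by (cases x; cases y) auto

text \<open>Orthogonality of characters: \<open>bit_char\<close> is the character x |-> (-1)^x of
  the two-element field, so half of \<open>1 + bit_char (f j v + y j)\<close> is the indicator of
  \<open>f j v = y j\<close>. The product over \<open>J\<close> expands into one term for each
  subset \<open>T\<close>, and balance leaves only the empty \<open>T\<close>.\<close>

lemma card_solutions_balanced:
  fixes f :: "'j \<Rightarrow> 'v \<Rightarrow> bit"
  assumes "finite J" "finite V"
    and balanced: "\<And>T. T \<subseteq> J \<Longrightarrow> T \<noteq> {} \<Longrightarrow> (\<Sum>v\<in>V. bit_char (\<Sum>j\<in>T. f j v)) = 0"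
  shows "2 ^ card J * real (card {v\<in>V. \<forall>j\<in>J. f j v = y j}) = real (card V)"
proof -
  have *: "(\<Prod>j\<in>J. 1 + bit_char (f j v + y j)) = 2 ^ card J * of_bool (\<forall>j\<in>J. f j v = y j)" for v
  proof (cases "\<forall>j\<in>J. f j v = y j")
    case True
    then have "(\<Prod>j\<in>J. 1 + bit_char (f j v + y j)) = (\<Prod>j\<in>J. 2)"
      by (intro prod.cong refl) (subst one_plus_bit_char, simp)
    with True show ?thesis by simp
  next
    case False
    then show ?thesis
      using \<open>finite J\<close> by (auto simp: one_plus_bit_char simp del: add_bit_eq_xor)
  qed
  have **: "(\<Prod>j\<in>J. 1 + bit_char (f j v + y j)) =
      (\<Sum>T\<in>Pow J. bit_char (\<Sum>j\<in>T. f j v) * bit_char (\<Sum>j\<in>T. y j))" for v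
    by (subst add.commute, subst prod_add[OF \<open>finite J\<close>])
       (simp add: bit_char_sum bit_char_add prod.distrib del: add_bit_eq_xor)
  have "2 ^ card J * real (card {v\<in>V. \<forall>j\<in>J. f j v = y j}) =
      (\<Sum>v\<in>V. 2 ^ card J * of_bool (\<forall>j\<in>J. f j v = y j))"
    using \<open>finite V\<close> by (simp add: sum_distrib_left[symmetric] Int_def)
  also have "\<dots> = (\<Sum>v\<in>V. \<Sum>T\<in>Pow J. bit_char (\<Sum>j\<in>T. f j v) * bit_char (\<Sum>j\<in>T. y j))"
    by (simp only: *[symmetric] **)
  also have "\<dots> = (\<Sum>T\<in>Pow J. (\<Sum>v\<in>V. bit_char (\<Sum>j\<in>T. f j v)) * bit_char (\<Sum>j\<in>T. y j))"
    by (subst sum.swap) (simp add: sum_distrib_right)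
  also have "\<dots> = (\<Sum>T\<in>{{}}. (\<Sum>v\<in>V. bit_char (\<Sum>j\<in>T. f j v)) * bit_char (\<Sum>j\<in>T. y j))"
    by (rule sum.mono_neutral_right) (use \<open>finite J\<close> balanced in auto)
  also have "\<dots> = real (card V)" by simp
  finally show ?thesis .
qed

text \<open>Flipping the bit of \<open>n\<close> that belongs to column \<open>l\<close> adds 1 to
  the form and so changes the sign; this involution pairs off the terms. Columns are numbered from 1
  and bits from 0, hence \<open>l - 1\<close>.\<close>

lemma sum_bit_char_linear_form:
  assumes "l \<in> {1..m}" "g l = 1"
  shows "(\<Sum>n<2 ^ m. bit_char (\<Sum>k=1..m. g k * of_bool (bit (n::nat) (k - 1)))) = 0"
proof -
  let ?f = "\<lambda>n::nat. bit_char (\<Sum>k=1..m. g k * of_bool (bit n (k - 1)))"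
  let ?t = "\<lambda>n::nat. flip_bit (l - 1) n"
  have flip: "?f (?t n) = - ?f n" for n
  proof -
    have "g k * of_bool (bit (?t n) (k - 1)) =
        g k * of_bool (bit n (k - 1)) + of_bool (k = l)" if "k \<in> {1..m}" for k
      using assms that by (cases "k = l") (auto simp: bit_flip_bit_iff)
    then have "(\<Sum>k=1..m. g k * of_bool (bit (?t n) (k - 1))) =
        (\<Sum>k=1..m. g k * of_bool (bit n (k - 1)) + of_bool (k = l))"
      by (rule sum.cong[OF refl])
    also have "\<dots> = (\<Sum>k=1..m. g k * of_bool (bit n (k - 1))) + 1"
      using assms(1) by (simp add: sum.distrib of_bool_def sum.delta del: add_bit_eq_xor)
    finally show ?thesis by (simp add: bit_char_add del: add_bit_eq_xor)
  qed
  have inv: "?t (?t n) = n" for n by (rule bit_eqI) (auto simp: bit_flip_bit_iff)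
  have "?t n < 2 ^ m" if "n < 2 ^ m" for n
  proof -
    have "take_bit m (?t n) = ?t n"
      using assms(1) that by (subst take_bit_flip_bit_eq) (auto simp: take_bit_nat_eq_self)
    then show ?thesis by (metis take_bit_nat_less_exp)
  qed
  then have "bij_betw ?t {..<2 ^ m} {..<2 ^ m}"
    by (intro bij_betwI[where g = ?t]) (auto simp: inv[simplified])
  then have "(\<Sum>n<2 ^ m. ?f n) = (\<Sum>n<2 ^ m. ?f (?t n))"
    by (rule sum.reindex_bij_betw[symmetric])
  also have "\<dots> = - (\<Sum>n<2 ^ m. ?f n)"
    unfolding flip by (rule sum_negf)
  finally show ?thesis by linarith
qed

section \<open>Elementary boxes of a digital net\<close>

definition net_digit :: "nat \<Rightarrow> (nat \<Rightarrow> nat \<Rightarrow> nat \<Rightarrow> bit) \<Rightarrow> nat \<Rightarrow> nat \<Rightarrow> nat \<Rightarrow> bit"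
  where "net_digit m A n i k = (\<Sum>l=1..m. A i k l * of_bool (bit n (l - 1)))"

text \<open>By independence, the sum of any non-empty set \<open>T\<close> of the rows is a non-zero
  linear form in the bits of \<open>n\<close>, hence balanced. So every pattern \<open>y\<close> of
  prescribed digits is attained by the same number of points.\<close>

lemma card_net_digits:
  assumes "finite u" and indep: "rows_independent u m d A"
  shows "2 ^ (\<Sum>i\<in>u. d i) *
      real (card {n\<in>{..<2 ^ m}. \<forall>i\<in>u. \<forall>k\<in>{1..d i}. net_digit m A n i k = y i k}) = 2 ^ m"
proof -
  let ?J = "Sigma u (\<lambda>i. {1..d i})"
  have "(\<Sum>n<2 ^ m. bit_char (\<Sum>j\<in>T. net_digit m A n (fst j) (snd j))) = 0"
    if T: "T \<subseteq> ?J" "T \<noteq> {}" for T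
  proof -
    \<comment> \<open>Over the two-element field a choice of coefficients is a choice of rows:
      \<open>h\<close> is the indicator of \<open>T\<close>.\<close>
    define h where "h i k = (of_bool ((i, k) \<in> T) :: bit)" for i k
    define g where "g l = (\<Sum>i\<in>u. \<Sum>k=1..d i. h i k * A i k l)" for l
    obtain i k where "(i, k) \<in> T" using T by auto
    then have "h i k \<noteq> 0" "i \<in> u" "k \<in> {1..d i}" using T by (auto simp: h_def)
    then obtain l where l: "l \<in> {1..m}" "g l \<noteq> 0"
      using indep unfolding rows_independent_def g_def by blast
    have T': "(\<Sum>i\<in>u. \<Sum>k=1..d i. h i k * X i k) = (\<Sum>j\<in>T. X (fst j) (snd j))" for X
    proof -
      have "(\<Sum>i\<in>u. \<Sum>k=1..d i. h i k * X i k) = (\<Sum>j\<in>?J. h (fst j) (snd j) * X (fst j) (snd j))"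
        using \<open>finite u\<close> by (subst sum.Sigma) (auto simp: case_prod_unfold simp del: mult_bit_eq_and)
      also have "\<dots> = (\<Sum>j\<in>T. h (fst j) (snd j) * X (fst j) (snd j))"
        using \<open>finite u\<close> T(1) by (intro sum.mono_neutral_right) (auto simp: h_def)
      also have "\<dots> = (\<Sum>j\<in>T. X (fst j) (snd j))"
        by (intro sum.cong refl) (simp add: h_def)
      finally show ?thesis .
    qed
    have "(\<Sum>j\<in>T. net_digit m A n (fst j) (snd j)) =
        (\<Sum>l=1..m. g l * of_bool (bit n (l - 1)))" for n
      unfolding g_def net_digit_def T' sum_distrib_right by (rule sum.swap)
    then show ?thesis
      using sum_bit_char_linear_form[of l m g] l by simp
  qed
  then have "2 ^ card ?J * real (card {n\<in>{..<2 ^ m}. \<forall>j\<in>?J.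
      net_digit m A n (fst j) (snd j) = y (fst j) (snd j)}) = real (card {..<2 ^ m :: nat})"
    using \<open>finite u\<close> by (intro card_solutions_balanced) auto
  moreover have "card ?J = (\<Sum>i\<in>u. d i)" using \<open>finite u\<close> by simp
  moreover have "{n\<in>{..<2 ^ m}. \<forall>j\<in>?J. net_digit m A n (fst j) (snd j) = y (fst j) (snd j)} =
      {n\<in>{..<2 ^ m}. \<forall>i\<in>u. \<forall>k\<in>{1..d i}. net_digit m A n i k = y i k}"
    by auto
  ultimately show ?thesis by simp
qed

lemma rows_independent_mono:
  assumes "finite u" "rows_independent u m d' A" and le: "\<And>i. i \<in> u \<Longrightarrow> d i \<le> d' i"
  shows "rows_independent u m d A"
  unfolding rows_independent_def
proof (intro allI impI)
  fix h assume h: "\<forall>l\<in>{1..m}. (\<Sum>i\<in>u. \<Sum>k=1..d i. h i k * A i k l) = 0"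
  define h' where "h' i k = (if k \<le> d i then h i k else 0)" for i k
  have "(\<Sum>k=1..d' i. h' i k * A i k l) = (\<Sum>k=1..d i. h i k * A i k l)" if "i \<in> u" for i l
    using le[OF that] by (intro sum.mono_neutral_cong_right) (auto simp: h'_def)
  then have "\<forall>l\<in>{1..m}. (\<Sum>i\<in>u. \<Sum>k=1..d' i. h' i k * A i k l) = 0"
    using h by simp
  then have "\<forall>i\<in>u. \<forall>k\<in>{1..d' i}. h' i k = 0"
    using assms(2) unfolding rows_independent_def by blast
  then show "\<forall>i\<in>u. \<forall>k\<in>{1..d i}. h i k = 0"
    using le by (force simp: h'_def)
qed

text \<open>Serves to coarsen a box of too high an order to one of order exactly \<open>k\<close>.
  The coordinate added last takes what the others cannot supply.\<close>

lemma sum_eq_between: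
  fixes d :: "'a \<Rightarrow> nat"
  assumes "finite u" "k \<le> (\<Sum>i\<in>u. d i)"
  shows "\<exists>e. (\<forall>i\<in>u. e i \<le> d i) \<and> (\<Sum>i\<in>u. e i) = k"
  using assms
proof (induction u arbitrary: k rule: finite_induct)
  case (insert i u)
  obtain e where e: "\<forall>j\<in>u. e j \<le> d j" "(\<Sum>j\<in>u. e j) = min k (\<Sum>j\<in>u. d j)"
    using insert.IH[of "min k (\<Sum>j\<in>u. d j)"] by auto
  have "(\<Sum>j\<in>u. (e(i := k - min k (\<Sum>j\<in>u. d j))) j) = (\<Sum>j\<in>u. e j)"
    using insert.hyps by (intro sum.cong) auto
  then show ?case
    using insert e by (intro exI[of _ "e(i := k - min k (\<Sum>j\<in>u. d j))"]) auto
qed simp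

text \<open>A box of order at most \<open>m - t\<close> contains exactly its share of the points. A
  box of higher order lies in one of order \<open>m - t\<close>, which contains 2^t points, and its
  fair share is at most 2^t as well; two numbers between 0 and 2^t differ by at most 2^t.\<close>

lemma net_digits_discrepancy:
  assumes "finite u" "u \<noteq> {}" and net: "generates_digital_net t m u A"
  shows "\<bar>real (card {n\<in>{..<2 ^ m}. \<forall>i\<in>u. \<forall>k\<in>{1..d i}. net_digit m A n i k = y i k})
      - 2 ^ m / 2 ^ (\<Sum>i\<in>u. d i)\<bar> \<le> 2 ^ t"
proof -
  let ?c = "\<lambda>d. card {n\<in>{..<2 ^ m}. \<forall>i\<in>u. \<forall>k\<in>{1..d i}. net_digit m A n i k = y i k}"
  have tm: "t \<le> m" and indep: "\<And>d. (\<Sum>i\<in>u. d i) = m - t \<Longrightarrow> rows_independent u m d A"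
    using net by (auto simp: generates_digital_net_def)
  show ?thesis
  proof (cases "(\<Sum>i\<in>u. d i) \<le> m - t")
    case True
    obtain i where i: "i \<in> u" using \<open>u \<noteq> {}\<close> by auto
    \<comment> \<open>\<open>generates_digital_net\<close> speaks of exactly \<open>m - t\<close>
      rows, so all missing rows are given to a single coordinate; independence then passes to the
      subsystem.\<close>
    define d' where "d' = d(i := d i + (m - t - (\<Sum>i\<in>u. d i)))"
    have "(\<Sum>i\<in>u. d' i) = m - t"
      using True i \<open>finite u\<close> by (simp add: d'_def sum.remove[of u i])
    then have "rows_independent u m d' A" by (rule indep)
    then have "rows_independent u m d A"
      by (rule rows_independent_mono[OF \<open>finite u\<close>]) (auto simp: d'_def)
    from card_net_digits[OF \<open>finite u\<close> this, of y] show ?thesis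
      by (simp add: field_simps)
  next
    case False
    then obtain e where e: "\<And>i. i \<in> u \<Longrightarrow> e i \<le> d i" "(\<Sum>i\<in>u. e i) = m - t"
      using sum_eq_between[OF \<open>finite u\<close>, of "m - t" d] by auto
    have "?c d \<le> ?c e"
      using e(1) by (intro card_mono) (force intro: order_trans)+
    moreover have "2 ^ (m - t) * real (?c e) = 2 ^ m"
      using card_net_digits[OF \<open>finite u\<close> indep[OF e(2)], of y] e(2) by simp
    then have "real (?c e) = 2 ^ t"
      using tm by (simp add: power_diff field_simps)
    ultimately have "real (?c d) \<le> 2 ^ t" by linarith
    moreover have "2 ^ m / 2 ^ (\<Sum>i\<in>u. d i) \<le> (2 :: real) ^ t"
    proof -
      have "(2 :: real) ^ m \<le> 2 ^ (t + (\<Sum>i\<in>u. d i))"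
        using False by (intro power_increasing) auto
      then show ?thesis by (simp add: field_simps power_add)
    qed
    moreover have "0 \<le> real (?c d)" "0 \<le> 2 ^ m / (2 :: real) ^ (\<Sum>i\<in>u. d i)" by simp_all
    ultimately show ?thesis by linarith
  qed
qed

section \<open>Local discrepancy by dyadic cuts\<close>

text \<open>The coordinates as numerators over the common denominator 2^m, so that elementary
  intervals become classes of \<open>div 2 ^ j\<close>. The first digit is the most significant one,
  hence bit \<open>j\<close> holds digit \<open>m - j\<close>.\<close>

definition net_int :: "nat \<Rightarrow> (nat \<Rightarrow> nat \<Rightarrow> nat \<Rightarrow> bit) \<Rightarrow> nat \<Rightarrow> nat \<Rightarrow> nat"
  where "net_int m A n i = horner_sum of_bool 2 (map (\<lambda>j. net_digit m A n i (m - j) = 1) [0..<m])"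

lemma net_int_less: "net_int m A n i < 2 ^ m"
  unfolding net_int_def by (rule order_less_le_trans[OF horner_sum_of_bool_2_less]) simp

lemma bit_net_int: "bit (net_int m A n i) j \<longleftrightarrow> j < m \<and> net_digit m A n i (m - j) = 1"
  by (auto simp: net_int_def bit_horner_sum_bit_iff)

lemma digital_net_eq:
  assumes "i \<in> {1..s}"
  shows "digital_net m s A n i = real (net_int m A n i) / 2 ^ m"
proof -
  have "real (net_int m A n i) / 2 ^ m =
      (\<Sum>j<m. of_bool (net_digit m A n i (m - j) = 1) * 2 ^ j) / 2 ^ m"
    by (simp add: net_int_def horner_sum_eq_sum atLeast0LessThan)
  also have "\<dots> = (\<Sum>j<m. of_bool (net_digit m A n i (m - j) = 1) / 2 ^ (m - j))"
    unfolding sum_divide_distrib by (intro sum.cong refl) (simp add: power_diff field_simps)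
  also have "\<dots> = (\<Sum>k=1..m. of_bool (net_digit m A n i k = 1) / 2 ^ k)"
    by (rule sum.reindex_bij_witness[where i = "\<lambda>k. m - k" and j = "\<lambda>j. m - j"]) auto
  finally show ?thesis using assms by (simp add: digital_net_def net_digit_def)
qed

text \<open>Division by 2^j drops the last \<open>j\<close> digits, so the condition places the
  coordinate in the elementary interval [e 2^j / 2^m, (e + 1) 2^j / 2^m) and thereby fixes its first
  \<open>m - j\<close> digits.\<close>

lemma net_int_div_eq_iff:
  assumes "j \<le> m" "e < 2 ^ (m - j)"
  shows "net_int m A n i div 2 ^ j = e \<longleftrightarrow>
    (\<forall>k\<in>{1..m - j}. net_digit m A n i k = of_bool (bit e (m - j - k)))"
proof -
  have e: "bit e l \<Longrightarrow> l < m - j" for l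
    using assms(2) by (metis bit_take_bit_iff take_bit_nat_eq_self)
  have "net_int m A n i div 2 ^ j = e \<longleftrightarrow>
      (\<forall>l. bit (net_int m A n i) (j + l) = bit e l)"
    by (simp add: bit_eq_iff bit_drop_bit_eq flip: drop_bit_eq_div)
  also have "\<dots> \<longleftrightarrow> (\<forall>l<m - j. bit (net_int m A n i) (j + l) = bit e l)"
    using e by (metis bit_net_int less_diff_conv add.commute)
  also have "\<dots> \<longleftrightarrow> (\<forall>l<m - j. net_digit m A n i (m - j - l) = of_bool (bit e l))"
    by (auto simp: bit_net_int)
  also have "\<dots> \<longleftrightarrow> (\<forall>k\<in>{1..m - j}. net_digit m A n i k = of_bool (bit e (m - j - k)))"
  proof safe
    fix k assume "\<forall>l<m - j. net_digit m A n i (m - j - l) = of_bool (bit e l)" "k \<in> {1..m - j}"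
    then show "net_digit m A n i k = of_bool (bit e (m - j - k))"
      by (auto dest!: spec[of _ "m - j - k"])
  next
    fix l assume "\<forall>k\<in>{1..m - j}. net_digit m A n i k = of_bool (bit e (m - j - k))" "l < m - j"
    then show "net_digit m A n i (m - j - l) = of_bool (bit e l)"
      by (auto dest!: bspec[of _ _ "m - j - l"])
  qed
  finally show ?thesis .
qed

text \<open>If x < z, the highest bit \<open>j\<close> in which they differ is set in
  \<open>z\<close> and cleared in \<open>x\<close>. When bit \<open>j\<close> of \<open>z\<close> is
  set, \<open>z div 2 ^ j\<close> is odd, so \<open>x div 2 ^ j + 1 = z div 2 ^ j\<close> says
  precisely this, and at most one \<open>j\<close> qualifies. The induction strips the lowest
  bit.\<close>

lemma of_bool_less_eq_sum_dyadic:
  fixes x z :: nat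
  assumes "z < 2 ^ M"
  shows "(of_bool (x < z) :: real) =
    (\<Sum>j<M. of_bool (bit z j) * of_bool (x div 2 ^ j + 1 = z div 2 ^ j))"
  using assms
proof (induction M arbitrary: x z)
  case (Suc M)
  have "(\<Sum>j<Suc M. of_bool (bit z j) * of_bool (x div 2 ^ j + 1 = z div 2 ^ j)) =
      of_bool (odd z \<and> x + 1 = z) + (\<Sum>j<M. of_bool (bit (z div 2) j) *
        of_bool (x div 2 div 2 ^ j + 1 = z div 2 div 2 ^ j) :: real)"
    by (subst sum.lessThan_Suc_shift) (simp add: bit_Suc bit_0 div_mult2_eq of_bool_conj)
  also have "\<dots> = of_bool (odd z \<and> x + 1 = z) + of_bool (x div 2 < z div 2)"
    using Suc.prems by (subst Suc.IH[symmetric]) auto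
  also have "\<dots> = of_bool (x < z)"
    by (cases "odd z \<and> x + 1 = z"; cases "x div 2 < z div 2"; cases "x < z"; simp; presburger)
  finally show ?case by simp
qed simp

lemma eq_sum_bits:
  assumes "z < 2 ^ M"
  shows "real z = (\<Sum>j<M. of_bool (bit z j) * 2 ^ j)"
proof -
  have "z = horner_sum of_bool 2 (map (bit z) [0..<M])"
    using assms by (simp add: horner_sum_bit_eq_take_bit take_bit_nat_eq_self)
  also have "\<dots> = (\<Sum>j<M. of_bool (bit z j) * 2 ^ j)"
    by (simp add: horner_sum_eq_sum atLeast0LessThan)
  finally show ?thesis by (metis (mono_tags, lifting) of_bool_eq of_nat_sum of_nat_mult of_nat_power of_nat_numeral of_nat_of_bool sum.cong)
qed

text \<open>\<open>J\<close> selects one binary position for each \<open>Z i\<close>. If all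
  selected bits are set (\<open>B J = 1\<close>), the corresponding pieces form an elementary box,
  and \<open>Q J n\<close> is membership in it. Count and volume have the same expansion over
  \<open>J\<close>, so they are compared box by box.\<close>

lemma net_discrepancy_int:
  assumes "finite u" "u \<noteq> {}" and net: "generates_digital_net t m u A"
    and Z: "\<And>i. i \<in> u \<Longrightarrow> Z i \<le> 2 ^ m"
  shows "\<bar>real (card {n\<in>{..<2 ^ m}. \<forall>i\<in>u. net_int m A n i < Z i}) - 2 ^ m * (\<Prod>i\<in>u. real (Z i) / 2 ^ m)\<bar>
    \<le> 2 ^ t * real (m + 1) ^ card u"
proof -
  \<comment> \<open>\<open>Z i = 2 ^ m\<close> is allowed, so bit \<open>m\<close> may be set and
    each coordinate has \<open>m + 1\<close> positions.\<close>
  define S where "S = PiE u (\<lambda>_. {..<Suc m})"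
  define B where "B J = (\<Prod>i\<in>u. of_bool (bit (Z i) (J i)) :: real)" for J
  define Q where "Q J n \<longleftrightarrow> (\<forall>i\<in>u. net_int m A n i div 2 ^ J i + 1 = Z i div 2 ^ J i)" for J n
  have Zlt: "Z i < 2 ^ Suc m" if "i \<in> u" for i
    using Z[OF that] by (rule order_le_less_trans) simp
  have "real (card {n\<in>{..<2 ^ m}. \<forall>i\<in>u. net_int m A n i < Z i}) =
      (\<Sum>n<2 ^ m. of_bool (\<forall>i\<in>u. net_int m A n i < Z i))"
    by (simp add: Int_def)
  also have "\<dots> = (\<Sum>n<2 ^ m. \<Prod>i\<in>u. of_bool (net_int m A n i < Z i))"
    using \<open>finite u\<close> by (intro sum.cong refl) (auto simp: of_bool_def intro!: prod.neutral)
  also have "\<dots> = (\<Sum>n<2 ^ m. \<Prod>i\<in>u. \<Sum>j<Suc m. of_bool (bit (Z i) j) *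
      of_bool (net_int m A n i div 2 ^ j + 1 = Z i div 2 ^ j))"
    by (intro sum.cong prod.cong refl of_bool_less_eq_sum_dyadic Zlt)
  also have "\<dots> = (\<Sum>n<2 ^ m. \<Sum>J\<in>S. B J * (\<Prod>i\<in>u. of_bool (net_int m A n i div 2 ^ J i + 1 = Z i div 2 ^ J i)))"
    unfolding S_def B_def prod.distrib[symmetric]
    by (intro sum.cong refl prod_sum_PiE) (use \<open>finite u\<close> in auto)
  also have "\<dots> = (\<Sum>J\<in>S. B J * (\<Sum>n<2 ^ m. of_bool (Q J n)))"
  proof (subst sum.swap, intro sum.cong refl)
    fix J assume "J \<in> S"
    have "(\<Prod>i\<in>u. of_bool (net_int m A n i div 2 ^ J i + 1 = Z i div 2 ^ J i)) = (of_bool (Q J n) :: real)" for n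
      using \<open>finite u\<close> by (auto simp: of_bool_def Q_def intro!: prod.neutral)
    then show "(\<Sum>n<2 ^ m. B J * (\<Prod>i\<in>u. of_bool (net_int m A n i div 2 ^ J i + 1 = Z i div 2 ^ J i))) =
        B J * (\<Sum>n<2 ^ m. of_bool (Q J n))"
      by (simp only: sum_distrib_left)
  qed
  also have "\<dots> = (\<Sum>J\<in>S. B J * real (card {n\<in>{..<2 ^ m}. Q J n}))"
    by (simp add: Int_def)
  finally have count: "real (card {n\<in>{..<2 ^ m}. \<forall>i\<in>u. net_int m A n i < Z i}) =
    (\<Sum>J\<in>S. B J * real (card {n\<in>{..<2 ^ m}. Q J n}))" .
  have "(\<Prod>i\<in>u. real (Z i) / 2 ^ m) = (\<Prod>i\<in>u. \<Sum>j<Suc m. of_bool (bit (Z i) j) * (2 ^ j / 2 ^ m))"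
    by (intro prod.cong refl) (subst eq_sum_bits[OF Zlt], assumption, simp only: sum_divide_distrib times_divide_eq_right)
  also have "\<dots> = (\<Sum>J\<in>S. B J * (\<Prod>i\<in>u. 2 ^ J i / 2 ^ m))"
    unfolding S_def B_def prod.distrib[symmetric]
    by (intro prod_sum_PiE) (use \<open>finite u\<close> in auto)
  finally have vol: "2 ^ m * (\<Prod>i\<in>u. real (Z i) / 2 ^ m) = (\<Sum>J\<in>S. B J * (2 ^ m * (\<Prod>i\<in>u. 2 ^ J i / 2 ^ m)))"
    by (simp add: sum_distrib_left mult_ac)
  have term_le: "\<bar>B J * real (card {n\<in>{..<2 ^ m}. Q J n}) - B J * (2 ^ m * (\<Prod>i\<in>u. 2 ^ J i / 2 ^ m))\<bar> \<le> 2 ^ t"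
    if J: "J \<in> S" for J
  proof (cases "\<forall>i\<in>u. bit (Z i) (J i)")
    case False
    then have "B J = 0" using \<open>finite u\<close> by (auto simp: B_def)
    then show ?thesis by simp
  next
    case True
    then have "B J = 1" by (simp add: B_def)
    have Jm: "J i \<le> m" if "i \<in> u" for i
      using J that by (force simp: S_def PiE_iff)
    \<comment> \<open>The piece cut off at bit \<open>J i\<close> is the interval with number
      \<open>e i\<close> among those of length 2^-(d i). The selected bit is set, so the quotient is
      odd and the subtraction of 1 is not truncated.\<close>
    define e where "e i = Z i div 2 ^ J i - 1" for i
    define d where "d i = m - J i" for i
    have e: "e i < 2 ^ d i" "Z i div 2 ^ J i = e i + 1" if "i \<in> u" for i
    proof -
      have "odd (Z i div 2 ^ J i)" using True that by (simp add: bit_iff_odd)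
      then show "Z i div 2 ^ J i = e i + 1" by (auto simp: e_def elim: oddE)
      have "Z i div 2 ^ J i \<le> 2 ^ m div 2 ^ J i"
        using Z[OF that] by (rule div_le_mono)
      also have "2 ^ m div 2 ^ J i = (2 ^ d i :: nat)" using Jm[OF that] by (simp add: d_def power_diff)
      finally have "Z i div 2 ^ J i \<le> 2 ^ d i" .
      moreover have "0 < Z i div 2 ^ J i" using \<open>odd (Z i div 2 ^ J i)\<close> by (rule odd_pos)
      ultimately show "e i < 2 ^ d i" unfolding e_def by linarith
    qed
    have "Q J n \<longleftrightarrow> (\<forall>i\<in>u. \<forall>k\<in>{1..d i}. net_digit m A n i k = of_bool (bit (e i) (d i - k)))" for n
      unfolding Q_def
    proof (intro ball_cong refl)
      fix i assume i: "i \<in> u"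
      have "net_int m A n i div 2 ^ J i + 1 = Z i div 2 ^ J i \<longleftrightarrow> net_int m A n i div 2 ^ J i = e i"
        using e(2)[OF i] by simp
      also have "\<dots> \<longleftrightarrow> (\<forall>k\<in>{1..d i}. net_digit m A n i k = of_bool (bit (e i) (d i - k)))"
        using net_int_div_eq_iff[of "J i" m "e i" A n i] Jm[OF i] e(1)[OF i] by (simp add: d_def)
      finally show "net_int m A n i div 2 ^ J i + 1 = Z i div 2 ^ J i \<longleftrightarrow>
        (\<forall>k\<in>{1..d i}. net_digit m A n i k = of_bool (bit (e i) (d i - k)))" .
    qed
    moreover have "(\<Prod>i\<in>u. 2 ^ J i / 2 ^ m) = 1 / (2 :: real) ^ (\<Sum>i\<in>u. d i)"
    proof -
      have "(\<Prod>i\<in>u. 2 ^ J i / 2 ^ m) = (\<Prod>i\<in>u. 1 / (2 :: real) ^ d i)"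
        using Jm by (intro prod.cong refl) (simp add: d_def power_diff)
      then show ?thesis by (simp add: prod_dividef power_sum)
    qed
    ultimately show ?thesis
      using net_digits_discrepancy[OF assms(1-3), of d "\<lambda>i k. of_bool (bit (e i) (d i - k))"]
      by (simp add: \<open>B J = 1\<close>)
  qed
  have "\<bar>\<Sum>J\<in>S. B J * real (card {n\<in>{..<2 ^ m}. Q J n}) - B J * (2 ^ m * (\<Prod>i\<in>u. 2 ^ J i / 2 ^ m))\<bar>
      \<le> (\<Sum>J\<in>S. 2 ^ t)"
    by (rule order_trans[OF sum_abs]) (intro sum_mono term_le)
  also have "\<dots> = 2 ^ t * real (m + 1) ^ card u"
    using \<open>finite u\<close> by (simp add: S_def card_PiE)
  finally show ?thesis unfolding count vol sum_subtractf[symmetric] .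
qed

text \<open>The net lives on multiples of 2^-m, so rounding each \<open>z i\<close> up to such a
  multiple leaves the count unchanged and alters only the volume, by at most
  \<open>card u / 2 ^ m\<close>.\<close>

lemma net_discrepancy:
  assumes "u \<subseteq> {1..s}" "u \<noteq> {}" "1 \<le> m" and net: "generates_digital_net t m u A"
    and z: "\<And>i. i \<in> u \<Longrightarrow> 0 \<le> z i \<and> z i \<le> 1"
  shows "\<bar>real (card {n\<in>{..<2 ^ m}. \<forall>i\<in>u. digital_net m s A n i < z i}) / 2 ^ m - (\<Prod>i\<in>u. z i)\<bar>
    \<le> 3 * 2 ^ t * (2 * real m) ^ card u / 2 ^ m"
proof -
  have "finite u" using assms(1) finite_subset by auto
  define Z where "Z i = nat \<lceil>2 ^ m * z i\<rceil>" for i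
  have Z: "Z i \<le> 2 ^ m" "\<bar>z i - real (Z i) / 2 ^ m\<bar> \<le> 1 / 2 ^ m" if "i \<in> u" for i
  proof -
    have nn: "0 \<le> 2 ^ m * z i" and "2 ^ m * z i \<le> 2 ^ m" using z[OF that] by auto
    then have "\<lceil>2 ^ m * z i\<rceil> \<le> 2 ^ m" by (simp add: ceiling_le_iff)
    then show "Z i \<le> 2 ^ m" by (simp add: Z_def nat_le_iff)
    have "2 ^ m * z i \<le> real (Z i)" "real (Z i) \<le> 2 ^ m * z i + 1"
      using nn by (auto simp: Z_def of_nat_nat)
    then have "\<bar>2 ^ m * z i - real (Z i)\<bar> / 2 ^ m \<le> 1 / 2 ^ m"
      by (intro divide_right_mono) auto
    moreover have "z i - real (Z i) / 2 ^ m = (2 ^ m * z i - real (Z i)) / 2 ^ m"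
      by (simp add: diff_divide_distrib)
    ultimately show "\<bar>z i - real (Z i) / 2 ^ m\<bar> \<le> 1 / 2 ^ m" by simp
  qed
  have less: "digital_net m s A n i < z i \<longleftrightarrow> net_int m A n i < Z i" if "i \<in> u" for n i
  proof -
    have "digital_net m s A n i < z i \<longleftrightarrow> real (net_int m A n i) < 2 ^ m * z i"
      using that assms(1) by (subst digital_net_eq) (auto simp: field_simps)
    also have "\<dots> \<longleftrightarrow> int (net_int m A n i) < \<lceil>2 ^ m * z i\<rceil>"
      by (simp add: less_ceiling_iff)
    also have "\<dots> \<longleftrightarrow> net_int m A n i < Z i" by (simp add: Z_def zless_nat_conj) linarith
    finally show ?thesis .
  qed
  let ?N = "real (card {n\<in>{..<2 ^ m}. \<forall>i\<in>u. net_int m A n i < Z i})"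
  let ?k = "card u"
  have "\<bar>(\<Prod>i\<in>u. z i) - (\<Prod>i\<in>u. real (Z i) / 2 ^ m)\<bar> \<le> (\<Sum>i\<in>u. \<bar>z i - real (Z i) / 2 ^ m\<bar>)"
  proof -
    have "real (Z i) \<le> 2 ^ m" if "i \<in> u" for i
      using Z(1)[OF that] by (metis of_nat_le_iff of_nat_numeral of_nat_power)
    then show ?thesis
      using norm_prod_diff[of u z "\<lambda>i. real (Z i) / 2 ^ m"] z by simp
  qed
  also have "\<dots> \<le> (\<Sum>i\<in>u. 1 / 2 ^ m)" by (intro sum_mono Z(2))
  finally have 1: "\<bar>(\<Prod>i\<in>u. z i) - (\<Prod>i\<in>u. real (Z i) / 2 ^ m)\<bar> \<le> real ?k / 2 ^ m" by simp
  have "\<bar>?N / 2 ^ m - (\<Prod>i\<in>u. real (Z i) / 2 ^ m)\<bar> = \<bar>?N - 2 ^ m * (\<Prod>i\<in>u. real (Z i) / 2 ^ m)\<bar> / 2 ^ m"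
    by (simp add: abs_div field_simps del: prod_dividef)
  also have "\<dots> \<le> 2 ^ t * real (m + 1) ^ ?k / 2 ^ m"
    by (intro divide_right_mono net_discrepancy_int assms \<open>finite u\<close> Z(1)) auto
  finally have 2: "\<bar>?N / 2 ^ m - (\<Prod>i\<in>u. real (Z i) / 2 ^ m)\<bar> \<le> 2 ^ t * real (m + 1) ^ ?k / 2 ^ m" .
  have "real (m + 1) ^ ?k \<le> (2 * real m) ^ ?k"
    using \<open>1 \<le> m\<close> by (intro power_mono) auto
  then have 3: "2 ^ t * real (m + 1) ^ ?k \<le> 2 ^ t * (2 * real m) ^ ?k" by simp
  \<comment> \<open>Absorbs the rounding error into the main term, through k <= 2^k <= (2
    m)^k.\<close>
  have "real ?k \<le> 2 ^ ?k" by (metis less_exp of_nat_less_numeral_power_cancel_iff less_imp_le)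
  also have "(2 :: real) ^ ?k \<le> (2 * real m) ^ ?k"
    using \<open>1 \<le> m\<close> by (intro power_mono) auto
  also have "\<dots> = 1 * (2 * real m) ^ ?k" by simp
  also have "\<dots> \<le> 2 ^ t * (2 * real m) ^ ?k" by (intro mult_right_mono) auto
  finally have 4: "real ?k \<le> 2 ^ t * (2 * real m) ^ ?k" .
  have 5: "0 \<le> (2 :: real) ^ t * (2 * real m) ^ ?k" by simp
  have sets: "{n\<in>{..<2 ^ m}. \<forall>i\<in>u. digital_net m s A n i < z i} = {n\<in>{..<2 ^ m}. \<forall>i\<in>u. net_int m A n i < Z i}"
    using less by auto
  have "\<bar>real (card {n\<in>{..<2 ^ m}. \<forall>i\<in>u. digital_net m s A n i < z i}) / 2 ^ m - (\<Prod>i\<in>u. z i)\<bar>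
      \<le> 2 ^ t * real (m + 1) ^ ?k / 2 ^ m + real ?k / 2 ^ m"
    unfolding arg_cong[OF sets, of card]
    by (rule order_trans[OF _ add_mono[OF 2 1]]) linarith
  also have "\<dots> \<le> 3 * (2 ^ t * (2 * real m) ^ ?k) / 2 ^ m"
  proof -
    have "2 ^ t * real (m + 1) ^ ?k + real ?k \<le> 3 * (2 ^ t * (2 * real m) ^ ?k)"
      using 3 4 5 by linarith
    then show ?thesis
      unfolding add_divide_distrib[symmetric] by (rule divide_right_mono) simp
  qed
  finally show ?thesis by (simp add: mult_ac)
qed

subsection \<open>Finite differences\<close>

text \<open>Folded in the same order as \<open>mixed_deriv\<close>: the direction at the end of the
  list is applied to \<open>F\<close> first. The value type is left open because the operator acts
  both on grid indices and on points of the box.\<close>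

definition diffs :: "('i \<Rightarrow> 'v) \<Rightarrow> ('i \<Rightarrow> 'v) \<Rightarrow> 'i list \<Rightarrow> (('i \<Rightarrow> 'v) \<Rightarrow> real) \<Rightarrow> ('i \<Rightarrow> 'v) \<Rightarrow> real"
  where "diffs l h = foldr (\<lambda>i H x. H (x(i := h i)) - H (x(i := l i)))"

lemma diffs_simps [simp]:
  "diffs l h [] F = F"
  "diffs l h (i # us) F x = diffs l h us F (x(i := h i)) - diffs l h us F (x(i := l i))"
  by (simp_all add: diffs_def)

lemma diffs_snoc:
  "diffs l h (us @ [i]) F = diffs l h us (\<lambda>x. F (x(i := h i)) - F (x(i := l i)))"
  by (simp add: diffs_def)

lemma diffs_minus: "diffs l h us (\<lambda>x. F x - G x) x = diffs l h us F x - diffs l h us G x"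
  by (induction us arbitrary: x) simp_all

lemma diffs_upd:
  "i \<notin> set us \<Longrightarrow> diffs l h us (\<lambda>x. F (x(i := c))) x = diffs l h us F (x(i := c))"
  by (induction us arbitrary: x) (auto simp: fun_upd_twist)

lemma diffs_cong:
  "(\<And>i. i \<in> set us \<Longrightarrow> l i = l' i \<and> h i = h' i) \<Longrightarrow> diffs l h us F x = diffs l' h' us F x"
  by (induction us arbitrary: x) auto

text \<open>Carries differences on the index grid over to differences on the box, with
  \<open>c\<close> the map from indices to grid points.\<close>

lemma diffs_comp:
  assumes "\<And>i x. i \<in> set us \<Longrightarrow> c (x(i := h i)) = (c x)(i := h' i)"
    and "\<And>i x. i \<in> set us \<Longrightarrow> c (x(i := l i)) = (c x)(i := l' i)"
  shows "diffs l h us (\<lambda>x. F (c x)) x = diffs l' h' us F (c x)"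
  using assms by (induction us arbitrary: x) auto

text \<open>Expanding from the right end \<open>K\<close> rather than from 0 produces the indicator
  of \<open>n \<le> j\<close>, which is what counting points in boxes anchored at the lower corner
  provides.\<close>

lemma telescope_from_end:
  fixes g :: "nat \<Rightarrow> real"
  assumes "n \<le> K"
  shows "g n = g K - (\<Sum>j<K. of_bool (n \<le> j) * (g (Suc j) - g j))"
  using assms
proof (induction K)
  case (Suc K)
  show ?case
  proof (cases "n = Suc K")
    case True
    then have "(\<Sum>j<Suc K. of_bool (n \<le> j) * (g (Suc j) - g j)) = 0"
      by (intro sum.neutral) auto
    with True show ?thesis by simp
  next
    case False
    with Suc show ?thesis by simp
  qed
qed simp

lemma sum_Pow_insert:
  assumes "finite A" "a \<notin> A"
  shows "(\<Sum>u\<in>Pow (insert a A). f u) = (\<Sum>u\<in>Pow A. f u) + (\<Sum>u\<in>Pow A. f (insert a u))"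
proof -
  have "inj_on (insert a) (Pow A)"
    using \<open>a \<notin> A\<close> by (intro inj_on_inverseI[where g = "\<lambda>X. X - {a}"]) auto
  moreover have "(\<Sum>u\<in>Pow (insert a A). f u) = (\<Sum>u\<in>Pow A. f u) + (\<Sum>u\<in>insert a ` Pow A. f u)"
    unfolding Pow_insert using assms by (intro sum.union_disjoint) auto
  ultimately show ?thesis by (simp add: sum.reindex)
qed

lemma sorted_list_of_set_insert_greatest:
  fixes i :: "'a :: linorder"
  assumes "finite u" "\<And>j. j \<in> u \<Longrightarrow> j < i"
  shows "sorted_list_of_set (insert i u) = sorted_list_of_set u @ [i]"
proof -
  have "sorted (sorted_list_of_set u @ [i])" "distinct (sorted_list_of_set u @ [i])"
    using assms by (auto simp: sorted_append dest: less_imp_le)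
  from sorted_list_of_set.idem_if_sorted_distinct[OF this] show ?thesis
    using assms(1) by simp
qed

text \<open>Abel summation, one coordinate at a time from the top; coordinates above
  \<open>r\<close> have already been moved to the end \<open>K\<close>. Telescoping the next one
  leaves the sum with that coordinate at \<open>K\<close> and, for each \<open>j < K\<close>, a sum
  with \<open>G\<close> differenced and the weights restricted to indices at most \<open>j\<close>.
  The factor \<open>real K ^ card u\<close> counts the choices of \<open>J\<close> on
  \<open>u\<close>.\<close>

lemma grid_summation_bound:
  fixes G :: "(nat \<Rightarrow> nat) \<Rightarrow> real"
  assumes "r \<le> s"
    and \<kappa>: "\<And>\<omega>. \<omega> \<in> \<Omega> \<Longrightarrow> \<kappa> \<omega> \<in> PiE {1..s} (\<lambda>_. {..K})"
    and end': "\<And>\<omega> i. \<omega> \<in> \<Omega> \<Longrightarrow> i \<in> {r<..s} \<Longrightarrow> \<kappa> \<omega> i = K"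
    and M: "\<And>u J x. u \<subseteq> {1..r} \<Longrightarrow> J \<in> u \<rightarrow> {..<K} \<Longrightarrow> x \<in> PiE {1..s} (\<lambda>_. {..K}) \<Longrightarrow>
      \<bar>diffs J (\<lambda>i. Suc (J i)) (sorted_list_of_set u) G x\<bar> \<le> M u"
    and D: "\<And>u J. u \<subseteq> {1..r} \<Longrightarrow> J \<in> u \<rightarrow> {..<K} \<Longrightarrow>
      \<bar>\<Sum>\<omega>\<in>\<Omega>. w \<omega> * of_bool (\<forall>i\<in>u. \<kappa> \<omega> i \<le> J i)\<bar> \<le> D u"
  shows "\<bar>\<Sum>\<omega>\<in>\<Omega>. w \<omega> * G (\<kappa> \<omega>)\<bar> \<le> (\<Sum>u\<in>Pow {1..r}. real K ^ card u * M u * D u)"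
  using assms
proof (induction r arbitrary: G w \<kappa> M D)
  case 0
  \<comment> \<open>All coordinates sit at \<open>K\<close>: what remains is the total weight times
    one value of \<open>G\<close>, the term of the empty set.\<close>
  define k where "k = (\<lambda>i\<in>{1..s}. K)"
  have "\<kappa> \<omega> = k" if "\<omega> \<in> \<Omega>" for \<omega>
    using 0(2)[OF that] 0(3)[OF that] by (intro PiE_ext[of _ "{1..s}" "\<lambda>_. {..K}"]) (auto simp: k_def)
  then have "(\<Sum>\<omega>\<in>\<Omega>. w \<omega> * G (\<kappa> \<omega>)) = (\<Sum>\<omega>\<in>\<Omega>. w \<omega>) * G k"
    by (simp add: sum_distrib_right)
  moreover have "k \<in> PiE {1..s} (\<lambda>_. {..K})" by (auto simp: k_def)
  then have "\<bar>G k\<bar> \<le> M {}" "\<bar>\<Sum>\<omega>\<in>\<Omega>. w \<omega>\<bar> \<le> D {}"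
    using 0(4)[of "{}" _ k] 0(5)[of "{}"] by auto
  then have "\<bar>\<Sum>\<omega>\<in>\<Omega>. w \<omega>\<bar> * \<bar>G k\<bar> \<le> D {} * M {}"
    by (intro mult_mono) auto
  ultimately show ?case by (simp add: abs_mult mult_ac)
next
  case (Suc r)
  let ?i = "Suc r"
  have i: "?i \<in> {1..s}" using Suc.prems(1) by auto
  have Icc: "{1..Suc r} = insert ?i {1..r}" by auto
  define \<kappa>' where "\<kappa>' \<omega> = (\<kappa> \<omega>)(?i := K)" for \<omega>
  define Gj where "Gj j x = G (x(?i := Suc j)) - G (x(?i := j))" for j x
  define wj where "wj j \<omega> = w \<omega> * of_bool (\<kappa> \<omega> ?i \<le> j)" for j \<omega>
  have upd: "x(?i := j) \<in> PiE {1..s} (\<lambda>_. {..K})" if "x \<in> PiE {1..s} (\<lambda>_. {..K})" "j \<le> K" for x j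
    using that i by (auto simp: PiE_def extensional_def Pi_def)
  have \<kappa>': "\<kappa>' \<omega> \<in> PiE {1..s} (\<lambda>_. {..K})" if "\<omega> \<in> \<Omega>" for \<omega>
    unfolding \<kappa>'_def using Suc.prems(2)[OF that] by (rule upd) simp
  have end'': "\<kappa>' \<omega> i = K" if "\<omega> \<in> \<Omega>" "i \<in> {r<..s}" for \<omega> i
    using Suc.prems(3)[OF that(1), of i] that(2) by (auto simp: \<kappa>'_def)
  have same: "(\<forall>i\<in>u. \<kappa>' \<omega> i \<le> J i) \<longleftrightarrow> (\<forall>i\<in>u. \<kappa> \<omega> i \<le> J i)" if "u \<subseteq> {1..r}" for u \<omega> J
    using that by (intro ball_cong refl) (auto simp: \<kappa>'_def)
  have "\<bar>\<Sum>\<omega>\<in>\<Omega>. w \<omega> * G (\<kappa>' \<omega>)\<bar> \<le> (\<Sum>u\<in>Pow {1..r}. real K ^ card u * M u * D u)"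
  proof (rule Suc.IH)
    fix u J assume *: "u \<subseteq> {1..r}" "J \<in> u \<rightarrow> {..<K}"
    then have "u \<subseteq> {1..Suc r}" by auto
    with * show "\<bar>\<Sum>\<omega>\<in>\<Omega>. w \<omega> * of_bool (\<forall>i\<in>u. \<kappa>' \<omega> i \<le> J i)\<bar> \<le> D u"
      using Suc.prems(5) by (simp add: same)
  next
    fix u J x assume *: "u \<subseteq> {1..r}" "J \<in> u \<rightarrow> {..<K}" "x \<in> PiE {1..s} (\<lambda>_. {..K})"
    then have "u \<subseteq> {1..Suc r}" by auto
    then show "\<bar>diffs J (\<lambda>i. Suc (J i)) (sorted_list_of_set u) G x\<bar> \<le> M u"
      using *(2,3) by (rule Suc.prems(4))
  qed (use \<kappa>' end'' Suc.prems(1) in auto)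
  moreover have "\<bar>\<Sum>\<omega>\<in>\<Omega>. wj j \<omega> * Gj j (\<kappa>' \<omega>)\<bar> \<le>
      (\<Sum>u\<in>Pow {1..r}. real K ^ card u * M (insert ?i u) * D (insert ?i u))" if j: "j < K" for j
  proof (rule Suc.IH)
    fix u J x assume *: "u \<subseteq> {1..r}" "J \<in> u \<rightarrow> {..<K}" "x \<in> PiE {1..s} (\<lambda>_. {..K})"
    let ?J = "J(?i := j)"
    have fin: "finite u" using *(1) finite_subset by auto
    have ins: "insert ?i u \<subseteq> {1..Suc r}" "?J \<in> insert ?i u \<rightarrow> {..<K}"
      using * j by (auto simp: Pi_def)
    \<comment> \<open>The new direction is the greatest of its set, so it stands last in the list
      and its difference is the innermost one, which \<open>Gj\<close> already contains.\<close>
    have "sorted_list_of_set (insert ?i u) = sorted_list_of_set u @ [?i]"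
      using *(1) fin by (intro sorted_list_of_set_insert_greatest) auto
    then have "diffs ?J (\<lambda>i. Suc (?J i)) (sorted_list_of_set (insert ?i u)) G x =
        diffs ?J (\<lambda>i. Suc (?J i)) (sorted_list_of_set u) (Gj j) x"
      by (simp add: diffs_snoc Gj_def[abs_def])
    also have "\<dots> = diffs J (\<lambda>i. Suc (J i)) (sorted_list_of_set u) (Gj j) x"
      using *(1) fin by (intro diffs_cong) auto
    finally have "diffs ?J (\<lambda>i. Suc (?J i)) (sorted_list_of_set (insert ?i u)) G x =
        diffs J (\<lambda>i. Suc (J i)) (sorted_list_of_set u) (Gj j) x" .
    from Suc.prems(4)[OF ins *(3), unfolded this]
    show "\<bar>diffs J (\<lambda>i. Suc (J i)) (sorted_list_of_set u) (Gj j) x\<bar> \<le> M (insert ?i u)" .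
  next
    fix u J assume *: "u \<subseteq> {1..r}" "J \<in> u \<rightarrow> {..<K}"
    let ?J = "J(?i := j)"
    have ins: "insert ?i u \<subseteq> {1..Suc r}" "?J \<in> insert ?i u \<rightarrow> {..<K}"
      using * j by (auto simp: Pi_def)
    \<comment> \<open>The condition on the new coordinate comes from the weight \<open>wj\<close>,
      those on \<open>u\<close> from the indicator, where \<open>\<kappa>'\<close> agrees with
      \<open>\<kappa>\<close>.\<close>
    have "of_bool (\<kappa> \<omega> ?i \<le> j) * of_bool (\<forall>i\<in>u. \<kappa>' \<omega> i \<le> J i) =
        (of_bool (\<forall>i\<in>insert ?i u. \<kappa> \<omega> i \<le> ?J i) :: real)" for \<omega>
    proof -
      have "?i \<notin> u" using *(1) by auto
      then have "(\<forall>i\<in>insert ?i u. \<kappa> \<omega> i \<le> ?J i) \<longleftrightarrow> \<kappa> \<omega> ?i \<le> j \<and> (\<forall>i\<in>u. \<kappa> \<omega> i \<le> J i)"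
        by (metis fun_upd_other fun_upd_same insert_iff)
      then show ?thesis by (simp only: same[OF *(1)] of_bool_conj)
    qed
    then have "(\<Sum>\<omega>\<in>\<Omega>. wj j \<omega> * of_bool (\<forall>i\<in>u. \<kappa>' \<omega> i \<le> J i)) =
        (\<Sum>\<omega>\<in>\<Omega>. w \<omega> * of_bool (\<forall>i\<in>insert ?i u. \<kappa> \<omega> i \<le> ?J i))"
      by (simp only: wj_def mult.assoc)
    then show "\<bar>\<Sum>\<omega>\<in>\<Omega>. wj j \<omega> * of_bool (\<forall>i\<in>u. \<kappa>' \<omega> i \<le> J i)\<bar> \<le> D (insert ?i u)"
      using Suc.prems(5)[OF ins] by simp
  qed (use \<kappa>' end'' Suc.prems(1) in auto)
  then have "(\<Sum>j<K. \<bar>\<Sum>\<omega>\<in>\<Omega>. wj j \<omega> * Gj j (\<kappa>' \<omega>)\<bar>) \<le>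
      (\<Sum>j<K. \<Sum>u\<in>Pow {1..r}. real K ^ card u * M (insert ?i u) * D (insert ?i u))"
    by (intro sum_mono) auto
  moreover have "(\<Sum>j<K. \<Sum>u\<in>Pow {1..r}. real K ^ card u * M (insert ?i u) * D (insert ?i u)) =
      (\<Sum>u\<in>Pow {1..r}. real K ^ card (insert ?i u) * M (insert ?i u) * D (insert ?i u))"
  proof -
    have "card (insert ?i u) = Suc (card u)" if "u \<subseteq> {1..r}" for u
    proof -
      have "finite u" "?i \<notin> u" using that finite_subset by auto
      then show ?thesis by simp
    qed
    then show ?thesis by (simp add: sum_distrib_left mult_ac)
  qed
  moreover have "(\<Sum>\<omega>\<in>\<Omega>. w \<omega> * G (\<kappa> \<omega>)) =
      (\<Sum>\<omega>\<in>\<Omega>. w \<omega> * G (\<kappa>' \<omega>)) - (\<Sum>j<K. \<Sum>\<omega>\<in>\<Omega>. wj j \<omega> * Gj j (\<kappa>' \<omega>))"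
  proof -
    have "w \<omega> * G (\<kappa> \<omega>) = w \<omega> * G (\<kappa>' \<omega>) - (\<Sum>j<K. wj j \<omega> * Gj j (\<kappa>' \<omega>))" if "\<omega> \<in> \<Omega>" for \<omega>
    proof -
      have "\<kappa> \<omega> ?i \<le> K" using Suc.prems(2)[OF that] i by auto
      from telescope_from_end[OF this, of "\<lambda>j. G ((\<kappa> \<omega>)(?i := j))"]
      have "G (\<kappa> \<omega>) = G (\<kappa>' \<omega>) - (\<Sum>j<K. of_bool (\<kappa> \<omega> ?i \<le> j) * Gj j (\<kappa>' \<omega>))"
        by (simp add: \<kappa>'_def Gj_def)
      then show ?thesis
        by (simp only: wj_def right_diff_distrib sum_distrib_left mult.assoc)
    qed
    then have "(\<Sum>\<omega>\<in>\<Omega>. w \<omega> * G (\<kappa> \<omega>)) =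
        (\<Sum>\<omega>\<in>\<Omega>. w \<omega> * G (\<kappa>' \<omega>) - (\<Sum>j<K. wj j \<omega> * Gj j (\<kappa>' \<omega>)))"
      by (intro sum.cong) auto
    then show ?thesis by (simp add: sum_subtractf) (rule sum.swap)
  qed
  moreover have "(\<Sum>u\<in>Pow {1..Suc r}. real K ^ card u * M u * D u) =
      (\<Sum>u\<in>Pow {1..r}. real K ^ card u * M u * D u) +
      (\<Sum>u\<in>Pow {1..r}. real K ^ card (insert ?i u) * M (insert ?i u) * D (insert ?i u))"
    unfolding Icc by (rule sum_Pow_insert) auto
  moreover have "\<bar>\<Sum>j<K. \<Sum>\<omega>\<in>\<Omega>. wj j \<omega> * Gj j (\<kappa>' \<omega>)\<bar> \<le> (\<Sum>j<K. \<bar>\<Sum>\<omega>\<in>\<Omega>. wj j \<omega> * Gj j (\<kappa>' \<omega>)\<bar>)"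
    by (rule sum_abs)
  ultimately show ?case by linarith
qed

section \<open>Mixed differences bounded by mixed derivatives\<close>

lemma coord_box_upd:
  "x \<in> coord_box s a b \<Longrightarrow> i \<in> {1..s} \<Longrightarrow> t \<in> {a i..b i} \<Longrightarrow> x(i := t) \<in> coord_box s a b"
  by (auto simp: coord_box_def PiE_def extensional_def Pi_def)

text \<open>Differencing in the directions \<open>us\<close> is a signed finite sum of values of
  \<open>F\<close> in which coordinate \<open>i\<close> stays free, so it commutes with
  differentiation in direction \<open>i\<close>.\<close>

lemma diffs_has_vector_derivative:
  assumes "x \<in> coord_box s a b" "i \<in> {1..s}" "t \<in> {a i..b i}" "i \<notin> set us" "set us \<subseteq> {1..s}"
    and diff: "\<And>x. x \<in> coord_box s a b \<Longrightarrow>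
      (\<lambda>t. F (x(i := t))) differentiable (at (x i) within {a i..b i})"
    and lh: "\<And>j. j \<in> set us \<Longrightarrow> l j \<in> {a j..b j} \<and> h j \<in> {a j..b j}"
  shows "((\<lambda>t. diffs l h us F (x(i := t))) has_vector_derivative
    diffs l h us (partial_deriv a b i F) (x(i := t))) (at t within {a i..b i})"
  using assms(1,4,5) lh
proof (induction us arbitrary: x)
  case Nil
  have "x(i := t) \<in> coord_box s a b" using Nil assms(2,3) by (intro coord_box_upd)
  from diff[OF this] show ?case
    by (simp add: partial_deriv_def vector_derivative_works fun_upd_def cong: if_cong)
next
  case (Cons j us)
  have j: "j \<in> {1..s}" "j \<noteq> i" using Cons.prems by auto
  have "x(j := h j) \<in> coord_box s a b" "x(j := l j) \<in> coord_box s a b"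
    using Cons.prems(1,4) j(1) by (auto intro!: coord_box_upd)
  moreover have "i \<notin> set us" "set us \<subseteq> {1..s}"
    "\<And>j. j \<in> set us \<Longrightarrow> l j \<in> {a j..b j} \<and> h j \<in> {a j..b j}"
    using Cons.prems by auto
  ultimately show ?case
    unfolding diffs_simps fun_upd_twist[OF j(2)[symmetric]]
    by (intro has_vector_derivative_diff Cons.IH)
qed

text \<open>Applied to \<open>F\<close> itself, the mean value theorem would give another
  intermediate point at each corner of the box. It is therefore applied to the whole function
  \<open>t \<mapsto> diffs l h us F (x(i := t))\<close>; one \<open>\<xi>\<close> results, and the
  induction continues with \<open>partial_deriv a b i F\<close> in place of
  \<open>F\<close>.\<close>

lemma diffs_bound:
  assumes "distinct us" "set us \<subseteq> {1..s}" "x \<in> coord_box s a b"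
    and lh: "\<And>j. j \<in> set us \<Longrightarrow> a j \<le> l j \<and> l j \<le> h j \<and> h j \<le> b j"
    and diff: "\<And>ys j zs x. us = ys @ j # zs \<Longrightarrow> x \<in> coord_box s a b \<Longrightarrow>
      (\<lambda>t. foldr (partial_deriv a b) zs F (x(j := t))) differentiable (at (x j) within {a j..b j})"
    and S: "\<And>x. x \<in> coord_box s a b \<Longrightarrow> \<bar>foldr (partial_deriv a b) us F x\<bar> \<le> S"
  shows "\<bar>diffs l h us F x\<bar> \<le> S * (\<Prod>i\<in>set us. h i - l i)"
  using assms
proof (induction us arbitrary: F x rule: rev_induct)
  case (snoc i us)
  let ?D = "partial_deriv a b i F"
  have i: "i \<in> {1..s}" "i \<notin> set us" "a i \<le> l i" "l i \<le> h i" "h i \<le> b i"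
    using snoc.prems(1,2) snoc.prems(4)[of i] by auto
  have IH: "\<bar>diffs l h us ?D y\<bar> \<le> S * (\<Prod>i\<in>set us. h i - l i)" if "y \<in> coord_box s a b" for y
  proof (rule snoc.IH[OF _ _ that])
    fix ys j zs x assume "us = ys @ j # zs" "x \<in> coord_box s a b"
    then show "(\<lambda>t. foldr (partial_deriv a b) zs ?D (x(j := t))) differentiable
        (at (x j) within {a j..b j})"
      using snoc.prems(5)[of ys j "zs @ [i]" x] by (simp add: fun_upd_def)
  qed (use snoc.prems in auto)
  have deriv: "((\<lambda>t. diffs l h us F (x(i := t))) has_vector_derivative
      diffs l h us ?D (x(i := t))) (at t within {a i..b i})" if "t \<in> {a i..b i}" for t
  proof (rule diffs_has_vector_derivative[OF snoc.prems(3) i(1) that i(2)])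
    show "(\<lambda>t. F (x(i := t))) differentiable (at (x i) within {a i..b i})"
      if "x \<in> coord_box s a b" for x
      using snoc.prems(5)[of us i "[]" x] that by (simp add: fun_upd_def)
  qed (use snoc.prems(2,4) in force)+
  have "((\<lambda>t. diffs l h us F (x(i := t))) has_derivative (\<lambda>e. e *\<^sub>R diffs l h us ?D (x(i := t))))
      (at t within {l i..h i})" if "l i \<le> t" "t \<le> h i" for t
    using deriv[of t] that i unfolding has_vector_derivative_def
    by (auto intro: has_derivative_subset)
  from mvt_very_simple[OF i(4) this] obtain \<xi> where \<xi>: "\<xi> \<in> {l i..h i}"
    "diffs l h us F (x(i := h i)) - diffs l h us F (x(i := l i)) =
      (h i - l i) * diffs l h us ?D (x(i := \<xi>))"
    by auto
  have "diffs l h (us @ [i]) F x = (h i - l i) * diffs l h us ?D (x(i := \<xi>))"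
    using i(2) by (simp add: diffs_snoc diffs_minus diffs_upd \<xi>(2))
  then have "\<bar>diffs l h (us @ [i]) F x\<bar> = (h i - l i) * \<bar>diffs l h us ?D (x(i := \<xi>))\<bar>"
    using i(4) by (simp add: abs_mult)
  also have "\<dots> \<le> (h i - l i) * (S * (\<Prod>i\<in>set us. h i - l i))"
    using i \<xi>(1) snoc.prems(3) by (intro mult_left_mono IH coord_box_upd) auto
  also have "\<dots> = S * (\<Prod>i\<in>set (us @ [i]). h i - l i)"
    using i(2) by simp
  finally show ?case .
qed auto

lemma mixed_deriv_empty [simp]: "mixed_deriv a b {} F = F"
  by (simp add: mixed_deriv_def)

text \<open>Every tail of the sorted list is the sorted list of a set whose elements exceed the
  entry before it. Those are the derivatives whose differentiability
  \<open>mixed_derivs_exist\<close> grants.\<close>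

lemma mixed_diffs_bound:
  assumes "mixed_derivs_exist s a b F" "u \<subseteq> {1..s}" "x \<in> coord_box s a b"
    and "\<And>j. j \<in> u \<Longrightarrow> a j \<le> l j \<and> l j \<le> h j \<and> h j \<le> b j"
    and "\<And>x. x \<in> coord_box s a b \<Longrightarrow> \<bar>mixed_deriv a b u F x\<bar> \<le> S"
  shows "\<bar>diffs l h (sorted_list_of_set u) F x\<bar> \<le> S * (\<Prod>i\<in>u. h i - l i)"
proof -
  have fin: "finite u" using assms(2) finite_subset by auto
  have "\<bar>diffs l h (sorted_list_of_set u) F x\<bar> \<le> S * (\<Prod>i\<in>set (sorted_list_of_set u). h i - l i)"
  proof (rule diffs_bound[OF _ _ assms(3)])
    fix ys j zs x assume us: "sorted_list_of_set u = ys @ j # zs" and x: "x \<in> coord_box s a b"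
    have sd: "sorted (ys @ j # zs)" "distinct (ys @ j # zs)"
      unfolding us[symmetric] by auto
    have "set (ys @ j # zs) = u" unfolding us[symmetric] using fin by simp
    then have u: "set zs \<subseteq> u" "j \<in> u" by auto
    have "sorted_list_of_set (set zs) = zs"
      using sd by (intro sorted_list_of_set.idem_if_sorted_distinct) (auto simp: sorted_append)
    moreover have "\<forall>k\<in>set zs. j < k"
      using sd by (auto simp: sorted_append less_le)
    moreover have "set zs \<subseteq> {1..s}" "j \<in> {1..s}" using u assms(2) by auto
    then have "(\<forall>k\<in>set zs. j < k) \<longrightarrow> (\<lambda>t. mixed_deriv a b (set zs) F (x(j := t)))
        differentiable (at (x j) within {a j..b j})"
      using assms(1) x unfolding mixed_derivs_exist_def by blast
    ultimately show "(\<lambda>t. foldr (partial_deriv a b) zs F (x(j := t))) differentiable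
        (at (x j) within {a j..b j})"
      by (simp add: mixed_deriv_def)
  qed (use assms fin in \<open>auto simp: mixed_deriv_def\<close>)
  then show ?thesis using fin by simp
qed

text \<open>The path from \<open>x\<close> to \<open>y\<close> changes one coordinate at a time, so
  first-order derivatives suffice. The estimate serves to show that step functions on finer grids
  converge to \<open>F\<close>.\<close>

lemma mixed_derivs_exist_lipschitz:
  assumes F: "mixed_derivs_exist s a b F"
    and bdd: "\<And>i x. i \<in> {1..s} \<Longrightarrow> x \<in> coord_box s a b \<Longrightarrow> \<bar>mixed_deriv a b {i} F x\<bar> \<le> L i"
    and x: "x \<in> coord_box s a b" and y: "y \<in> coord_box s a b"
  shows "\<bar>F x - F y\<bar> \<le> (\<Sum>i=1..s. L i * \<bar>x i - y i\<bar>)"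
proof -
  have one: "\<bar>F (z(i := t)) - F (z(i := t'))\<bar> \<le> L i * \<bar>t - t'\<bar>"
    if z: "z \<in> coord_box s a b" and i: "i \<in> {1..s}" and t: "t \<in> {a i..b i}" "t' \<in> {a i..b i}" for z i t t'
  proof -
    have "\<bar>diffs (\<lambda>_. min t t') (\<lambda>_. max t t') (sorted_list_of_set {i}) F z\<bar>
        \<le> L i * (\<Prod>i\<in>{i}. max t t' - min t t')"
      by (rule mixed_diffs_bound[OF F _ z]) (use i t bdd[OF i] in auto)
    then show ?thesis by (auto simp: max_def min_def abs_minus_commute split: if_splits)
  qed
  define z where "z r = (\<lambda>i\<in>{1..s}. if i \<le> r then y i else x i)" for r
  have box: "z r \<in> coord_box s a b" for r
    using x y by (auto simp: z_def coord_box_def PiE_iff)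
  have "\<bar>F x - F (z r)\<bar> \<le> (\<Sum>i=1..r. L i * \<bar>x i - y i\<bar>)" if "r \<le> s" for r
    using that
  proof (induction r)
    case 0
    have "z 0 = x" using x by (auto simp: z_def coord_box_def fun_eq_iff PiE_def extensional_def)
    then show ?case by simp
  next
    case (Suc r)
    have i: "Suc r \<in> {1..s}" using Suc.prems by auto
    have "z r = (z r)(Suc r := x (Suc r))" "z (Suc r) = (z r)(Suc r := y (Suc r))"
      using i by (auto simp: z_def fun_eq_iff)
    moreover have "x (Suc r) \<in> {a (Suc r)..b (Suc r)}" "y (Suc r) \<in> {a (Suc r)..b (Suc r)}"
      using x y i unfolding coord_box_def by (meson PiE_mem)+
    ultimately have "\<bar>F (z r) - F (z (Suc r))\<bar> \<le> L (Suc r) * \<bar>x (Suc r) - y (Suc r)\<bar>"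
      using one[OF box i] by metis
    with Suc show ?case by simp
  qed
  from this[of s] have "\<bar>F x - F (z s)\<bar> \<le> (\<Sum>i=1..s. L i * \<bar>x i - y i\<bar>)" by simp
  moreover have "z s = y"
    using y by (auto simp: z_def coord_box_def fun_eq_iff PiE_def extensional_def)
  ultimately show ?thesis by simp
qed

subsection \<open>The Koksma-Hlawka inequality\<close>

definition cell :: "real \<Rightarrow> real \<Rightarrow> nat \<Rightarrow> real \<Rightarrow> nat"
  where "cell l u K t = nat \<lfloor>real K * (t - l) / (u - l)\<rfloor>"

definition grid_pt :: "real \<Rightarrow> real \<Rightarrow> nat \<Rightarrow> nat \<Rightarrow> real"
  where "grid_pt l u K j = l + (u - l) * real j / real K"

lemma cell_le_iff:
  assumes "l < u" "0 < K" "t \<in> {l..u}"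
  shows "cell l u K t \<le> j \<longleftrightarrow> t < grid_pt l u K (Suc j)"
proof -
  have "cell l u K t \<le> j \<longleftrightarrow> \<lfloor>real K * (t - l) / (u - l)\<rfloor> \<le> int j"
    by (auto simp: cell_def nat_le_iff)
  also have "\<dots> \<longleftrightarrow> real K * (t - l) / (u - l) < real j + 1"
    by (simp add: floor_le_iff)
  also have "\<dots> \<longleftrightarrow> real K * (t - l) < (u - l) * (real j + 1)"
    using assms by (simp add: divide_less_eq mult.commute)
  also have "\<dots> \<longleftrightarrow> t < grid_pt l u K (Suc j)"
  proof -
    have "grid_pt l u K (Suc j) - t = ((u - l) * (real j + 1) - real K * (t - l)) / real K"
      using assms by (simp add: grid_pt_def field_simps)
    moreover have "0 < ((u - l) * (real j + 1) - real K * (t - l)) / real K \<longleftrightarrow>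
        0 < (u - l) * (real j + 1) - real K * (t - l)"
      using assms by (simp add: zero_less_divide_iff)
    ultimately show ?thesis by linarith
  qed
  finally show ?thesis .
qed

lemma cell_le:
  assumes "l < u" "t \<in> {l..u}"
  shows "cell l u K t \<le> K"
proof -
  have "real K * (t - l) / (u - l) \<le> real K"
    using assms by (simp add: divide_le_eq mult_left_mono)
  then have "\<lfloor>real K * (t - l) / (u - l)\<rfloor> \<le> int K" by (simp add: floor_le_iff)
  then show ?thesis by (simp add: cell_def nat_le_iff)
qed

lemma grid_pt_mem:
  assumes "l < u" "0 < K" "j \<le> K"
  shows "grid_pt l u K j \<in> {l..u}"
proof -
  have "(u - l) * real j / real K \<le> u - l"
    using assms by (simp add: divide_le_eq mult_left_mono)
  moreover have "0 \<le> (u - l) * real j / real K" using assms by simp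
  ultimately show ?thesis by (auto simp: grid_pt_def)
qed

lemma grid_pt_cell:
  assumes "l < u" "0 < K" "t \<in> {l..u}"
  shows "\<bar>t - grid_pt l u K (cell l u K t)\<bar> \<le> (u - l) / real K"
proof -
  let ?x = "real K * (t - l) / (u - l)"
  have "0 \<le> ?x" using assms by simp
  then have c: "real (cell l u K t) \<le> ?x" "?x < real (cell l u K t) + 1"
    by (simp_all add: cell_def of_nat_nat)
  have t: "t = l + (u - l) / real K * ?x" using assms by simp
  have "t - grid_pt l u K (cell l u K t) = (u - l) / real K * (?x - real (cell l u K t))"
    by (subst t) (simp add: grid_pt_def algebra_simps)
  moreover have "\<bar>(u - l) / real K * (?x - real (cell l u K t))\<bar> \<le> (u - l) / real K * 1"
    unfolding abs_mult using assms c by (intro mult_mono) auto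
  ultimately show ?thesis by simp
qed

lemma grid_pt_diff: "grid_pt l u K (Suc j) - grid_pt l u K j = (u - l) / real K"
  unfolding grid_pt_def add_diff_cancel_left diff_divide_distrib[symmetric] right_diff_distrib[symmetric]
  by simp

lemma cell_sets_lebesgue: "{t \<in> {l..u}. Q (cell l u K t)} \<in> sets lebesgue"
proof -
  have "{t \<in> space borel. t \<in> {l..u} \<and> Q (cell l u K t)} \<in> sets borel"
    unfolding cell_def by measurable
  then show ?thesis by simp
qed

lemma singleton_AE_lebesgue: "AE t in lebesgue. t \<noteq> (c :: real)"
  by (rule AE_completion) (rule AE_lborel_singleton)

section \<open>One coordinate: cell masses and the distribution function\<close>

locale interval_density =
  fixes l u :: real and f :: "real \<Rightarrow> real"
  assumes less: "l < u" and density: "prob_density_on l u f"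
    and bij: "bij_betw (distr_fun l f) {l..u} {0..1}"
begin

definition dens :: "real \<Rightarrow> real"
  where "dens t = indicator {l..u} t * f t"

definition mass :: "nat \<Rightarrow> nat \<Rightarrow> real"
  where "mass K j = (\<integral>t. dens t * indicator {t \<in> {l..u}. cell l u K t = j} t \<partial>lebesgue)"

lemma dens_nonneg: "0 \<le> dens t"
  using density by (auto simp: dens_def prob_density_on_def indicator_def)

lemma integrable_dens: "integrable lebesgue dens"
  using density by (simp add: dens_def[abs_def] prob_density_on_def set_integrable_def)

lemma integral_dens: "(\<integral>t. dens t \<partial>lebesgue) = 1"
  using density by (simp add: dens_def[abs_def] prob_density_on_def set_lebesgue_integral_def)

lemma integrable_dens_indicator:
  "A \<in> sets lebesgue \<Longrightarrow> integrable lebesgue (\<lambda>t. dens t * indicator A t)"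
  using integrable_mult_indicator[OF _ integrable_dens] by (simp add: mult.commute)

lemma sum_mass: "(\<Sum>j\<le>J. mass K j) = (\<integral>t. dens t * indicator {t \<in> {l..u}. cell l u K t \<le> J} t \<partial>lebesgue)"
proof -
  have "(\<Sum>j\<le>J. mass K j) =
      (\<integral>t. (\<Sum>j\<le>J. dens t * indicator {t \<in> {l..u}. cell l u K t = j} t) \<partial>lebesgue)"
    unfolding mass_def
    by (rule Bochner_Integration.integral_sum[symmetric]) (intro integrable_dens_indicator cell_sets_lebesgue)
  also have "(\<lambda>t. \<Sum>j\<le>J. dens t * indicator {t \<in> {l..u}. cell l u K t = j} t) =
      (\<lambda>t. dens t * indicator {t \<in> {l..u}. cell l u K t \<le> J} t)"
  proof
    fix t
    have "(\<Sum>j\<le>J. indicator {t \<in> {l..u}. cell l u K t = j} t) =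
        (\<Sum>j\<le>J. if j = cell l u K t then of_bool (t \<in> {l..u}) else (0 :: real))"
      by (intro sum.cong) (auto simp: indicator_def)
    also have "\<dots> = indicator {t \<in> {l..u}. cell l u K t \<le> J} t"
      by (auto simp: indicator_def)
    finally show "(\<Sum>j\<le>J. dens t * indicator {t \<in> {l..u}. cell l u K t = j} t) =
        dens t * indicator {t \<in> {l..u}. cell l u K t \<le> J} t"
      by (simp only: sum_distrib_left[symmetric])
  qed
  finally show ?thesis .
qed

lemma distr_fun_eq:
  assumes "z \<in> {l..u}"
  shows "distr_fun l f z = (\<integral>t. dens t * indicator {l..z} t \<partial>lebesgue)"
  unfolding distr_fun_def set_lebesgue_integral_def dens_def
  by (rule Bochner_Integration.integral_cong) (use assms in \<open>auto simp: indicator_def\<close>)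

text \<open>The cells up to \<open>J\<close> fill the interval from \<open>l\<close> to the next
  grid point without that point, whereas the distribution function integrates over the closed
  interval; a single point is a null set.\<close>

lemma sum_mass_eq_distr_fun:
  assumes "J < K"
  shows "(\<Sum>j\<le>J. mass K j) = distr_fun l f (grid_pt l u K (Suc J))"
proof -
  let ?z = "grid_pt l u K (Suc J)"
  have z: "?z \<in> {l..u}" using less assms by (intro grid_pt_mem) auto
  have "(\<integral>t. dens t * indicator {t \<in> {l..u}. cell l u K t \<le> J} t \<partial>lebesgue) =
      (\<integral>t. dens t * indicator {l..?z} t \<partial>lebesgue)"
  proof (rule integral_cong_AE)
    show "AE t in lebesgue. dens t * indicator {t \<in> {l..u}. cell l u K t \<le> J} t =
        dens t * indicator {l..?z} t"
      using singleton_AE_lebesgue[of ?z]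
    proof eventually_elim
      case (elim t)
      then show ?case
        using cell_le_iff[OF less, of K t J] assms z by (auto simp: indicator_def)
    qed
  qed (rule borel_measurable_integrable, rule integrable_dens_indicator, (rule cell_sets_lebesgue | simp))+
  then show ?thesis by (simp only: sum_mass distr_fun_eq[OF z])
qed

lemma sum_mass_total: "(\<Sum>j\<le>K. mass K j) = 1"
proof -
  have "dens t * indicator {t \<in> {l..u}. cell l u K t \<le> K} t = dens t" for t
    using cell_le[OF less, of t K] by (auto simp: indicator_def dens_def)
  then show ?thesis unfolding sum_mass by (simp only: integral_dens)
qed

text \<open>Monotonicity comes from the non-negative density, strictness from the injectivity
  contained in \<open>bij\<close>.\<close>

lemma distr_fun_less_iff:
  assumes "x \<in> {l..u}" "z \<in> {l..u}"
  shows "distr_fun l f x < distr_fun l f z \<longleftrightarrow> x < z"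
proof -
  have mono: "distr_fun l f x \<le> distr_fun l f z" if "x \<in> {l..u}" "z \<in> {l..u}" "x \<le> z" for x z
    unfolding distr_fun_eq[OF that(1)] distr_fun_eq[OF that(2)]
    by (intro integral_mono integrable_dens_indicator)
       (use that dens_nonneg in \<open>auto simp: indicator_def\<close>)
  have inj: "x = z" if "distr_fun l f x = distr_fun l f z"
    using bij assms that by (auto simp: bij_betw_def inj_on_def)
  show ?thesis
    using mono[of x z] mono[of z x] inj assms by (metis leD leI order_le_less)
qed

lemma inverse_distr_fun:
  assumes "y \<in> {0..1}"
  shows "the_inv_into {l..u} (distr_fun l f) y \<in> {l..u}"
    and "distr_fun l f (the_inv_into {l..u} (distr_fun l f) y) = y"
proof -
  have inj: "inj_on (distr_fun l f) {l..u}" and im: "distr_fun l f ` {l..u} = {0..1}"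
    using bij by (auto simp: bij_betw_def)
  show "the_inv_into {l..u} (distr_fun l f) y \<in> {l..u}"
    using the_inv_into_into[OF inj, of y "{l..u}"] assms im by auto
  show "distr_fun l f (the_inv_into {l..u} (distr_fun l f) y) = y"
    using f_the_inv_into_f[OF inj, of y] assms im by auto
qed

lemma distr_fun_mem: "z \<in> {l..u} \<Longrightarrow> distr_fun l f z \<in> {0..1}"
  using bij by (auto simp: bij_betw_def)

end

section \<open>The box: grid, step functions and refinement\<close>

locale box_densities =
  fixes s :: nat and a b :: "nat \<Rightarrow> real" and \<phi> :: "nat \<Rightarrow> real \<Rightarrow> real"
  assumes interval_density: "i \<in> {1..s} \<Longrightarrow> interval_density (a i) (b i) (\<phi> i)"
begin

lemmas a_less_b = interval_density.less[OF interval_density]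

definition box_pt :: "nat \<Rightarrow> (nat \<Rightarrow> nat) \<Rightarrow> nat \<Rightarrow> real"
  where "box_pt K \<kappa> = (\<lambda>i\<in>{1..s}. grid_pt (a i) (b i) K (\<kappa> i))"

definition box_cell :: "nat \<Rightarrow> (nat \<Rightarrow> real) \<Rightarrow> nat \<Rightarrow> nat"
  where "box_cell K x = (\<lambda>i\<in>{1..s}. cell (a i) (b i) K (x i))"

abbreviation "indices K \<equiv> PiE {1..s} (\<lambda>_. {..K})"

abbreviation "cell_mass K i \<equiv> interval_density.mass (a i) (b i) (\<phi> i) K"

lemma coord_box_nth: "x \<in> coord_box s a b \<Longrightarrow> i \<in> {1..s} \<Longrightarrow> x i \<in> {a i..b i}"
  unfolding coord_box_def by (rule PiE_mem)

lemma box_cell_indices: "x \<in> coord_box s a b \<Longrightarrow> box_cell K x \<in> indices K"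
  using cell_le[OF a_less_b coord_box_nth] by (auto simp: box_cell_def)

lemma box_pt_mem: "0 < K \<Longrightarrow> \<kappa> \<in> indices K \<Longrightarrow> box_pt K \<kappa> \<in> coord_box s a b"
  using grid_pt_mem[OF a_less_b] by (auto simp: box_pt_def coord_box_def PiE_iff)

lemma box_pt_upd:
  "i \<in> {1..s} \<Longrightarrow> box_pt K (\<kappa>(i := j)) = (box_pt K \<kappa>)(i := grid_pt (a i) (b i) K j)"
  by (auto simp: box_pt_def fun_eq_iff)

text \<open>Only finitely many values of \<open>F\<close> enter, as coefficients of products of
  one-dimensional functions. This makes the step function integrable, and its integral computable
  coordinatewise, for an arbitrary \<open>F\<close>.\<close>

lemma step_function_eq:
  assumes "x \<in> space (PiM {1..s} (\<lambda>_. lebesgue))"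
  shows "indicator (coord_box s a b) x *\<^sub>R (F (box_pt K (box_cell K x)) * prod_density s \<phi> x) =
    (\<Sum>\<kappa>\<in>indices K. F (box_pt K \<kappa>) * (\<Prod>i=1..s. interval_density.dens (a i) (b i) (\<phi> i) (x i) *
      indicator {t \<in> {a i..b i}. cell (a i) (b i) K t = \<kappa> i} (x i)))"
    (is "_ = (\<Sum>\<kappa>\<in>_. F (box_pt K \<kappa>) * (\<Prod>i=1..s. ?d i * ?c \<kappa> i))")
proof (cases "x \<in> coord_box s a b")
  case True
  let ?\<kappa> = "box_cell K x"
  have zero: "(\<Prod>i=1..s. ?d i * ?c \<kappa> i) = 0" if \<kappa>: "\<kappa> \<in> indices K" "\<kappa> \<noteq> ?\<kappa>" for \<kappa>
  proof -
    obtain i where "i \<in> {1..s}" "\<kappa> i \<noteq> ?\<kappa> i"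
      using PiE_ext[OF \<kappa>(1) box_cell_indices[OF True]] \<kappa>(2) by blast
    then show ?thesis by (intro prod_zero) (auto simp: box_cell_def intro!: bexI[of _ i])
  qed
  have "(\<Sum>\<kappa>\<in>indices K. F (box_pt K \<kappa>) * (\<Prod>i=1..s. ?d i * ?c \<kappa> i)) =
      (\<Sum>\<kappa>\<in>{?\<kappa>}. F (box_pt K \<kappa>) * (\<Prod>i=1..s. ?d i * ?c \<kappa> i))"
    by (rule sum.mono_neutral_right) (use zero box_cell_indices[OF True] in \<open>auto intro: finite_PiE\<close>)
  also have "\<dots> = F (box_pt K ?\<kappa>) * (\<Prod>i=1..s. ?d i * ?c ?\<kappa> i)" by simp
  also have "(\<Prod>i=1..s. ?d i * ?c ?\<kappa> i) = prod_density s \<phi> x"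
    unfolding prod_density_def
    using coord_box_nth[OF True] interval_density
    by (intro prod.cong refl) (simp add: interval_density.dens_def box_cell_def)
  finally show ?thesis using True by simp
next
  case False
  then obtain i where i: "i \<in> {1..s}" "x i \<notin> {a i..b i}"
    using assms by (auto simp: coord_box_def space_PiM PiE_iff)
  then have "(\<Prod>i=1..s. ?d i * ?c \<kappa> i) = 0" for \<kappa>
    by (intro prod_zero) (auto intro!: bexI[of _ i])
  then show ?thesis using False by (simp only: mult_zero_right sum.neutral_const) simp
qed

text \<open>A countable cover of the line by sets of finite \<open>lborel\<close> measure serves for
  the completion as well.\<close>

lemma product_sigma_finite_lebesgue: "product_sigma_finite (\<lambda>_. lebesgue :: real measure)"
proof -
  obtain A :: "real set set" where A: "countable A" "A \<subseteq> sets lborel" "\<Union>A = space lborel"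
    "\<forall>X\<in>A. emeasure lborel X \<noteq> \<infinity>"
    using lborel.sigma_finite_countable by blast
  have "sigma_finite_measure (lebesgue :: real measure)"
    by standard (rule exI[of _ A], use A in \<open>auto simp: main_part_sets\<close>)
  then show ?thesis by (simp add: product_sigma_finite_def)
qed

lemma step_function_integral:
  shows "set_integrable (PiM {1..s} (\<lambda>_. lebesgue)) (coord_box s a b)
      (\<lambda>x. F (box_pt K (box_cell K x)) * prod_density s \<phi> x)"
    and "(LINT x:coord_box s a b|PiM {1..s} (\<lambda>_. lebesgue).
        F (box_pt K (box_cell K x)) * prod_density s \<phi> x) =
      (\<Sum>\<kappa>\<in>indices K. F (box_pt K \<kappa>) * (\<Prod>i=1..s. cell_mass K i (\<kappa> i)))"
proof -
  interpret product_sigma_finite "\<lambda>_::nat. lebesgue :: real measure"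
    by (rule product_sigma_finite_lebesgue)
  let ?M = "PiM {1..s} (\<lambda>_. lebesgue :: real measure)"
  define g where "g \<kappa> i t = interval_density.dens (a i) (b i) (\<phi> i) t *
      indicator {t \<in> {a i..b i}. cell (a i) (b i) K t = \<kappa> i} t" for \<kappa> :: "nat \<Rightarrow> nat" and i t
  have g: "integrable lebesgue (g \<kappa> i)" if "i \<in> {1..s}" for \<kappa> i
    unfolding g_def
    by (rule interval_density.integrable_dens_indicator[OF interval_density[OF that] cell_sets_lebesgue])
  have int: "integrable ?M (\<lambda>x. F (box_pt K \<kappa>) * (\<Prod>i=1..s. g \<kappa> i (x i)))" for \<kappa>
    by (intro integrable_mult_right product_integrable_prod g) auto
  have eq: "indicator (coord_box s a b) x *\<^sub>R (F (box_pt K (box_cell K x)) * prod_density s \<phi> x) =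
      (\<Sum>\<kappa>\<in>indices K. F (box_pt K \<kappa>) * (\<Prod>i=1..s. g \<kappa> i (x i)))" if "x \<in> space ?M" for x
    unfolding g_def by (rule step_function_eq[OF that])
  show "set_integrable ?M (coord_box s a b) (\<lambda>x. F (box_pt K (box_cell K x)) * prod_density s \<phi> x)"
    unfolding set_integrable_def
    by (subst Bochner_Integration.integrable_cong[OF refl eq], assumption)
       (intro Bochner_Integration.integrable_sum int)
  have "(LINT x:coord_box s a b|?M. F (box_pt K (box_cell K x)) * prod_density s \<phi> x) =
      (\<integral>x. (\<Sum>\<kappa>\<in>indices K. F (box_pt K \<kappa>) * (\<Prod>i=1..s. g \<kappa> i (x i))) \<partial>?M)"
    unfolding set_lebesgue_integral_def by (intro Bochner_Integration.integral_cong refl eq)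
  also have "\<dots> = (\<Sum>\<kappa>\<in>indices K. \<integral>x. F (box_pt K \<kappa>) * (\<Prod>i=1..s. g \<kappa> i (x i)) \<partial>?M)"
    by (intro Bochner_Integration.integral_sum int)
  also have "\<dots> = (\<Sum>\<kappa>\<in>indices K. F (box_pt K \<kappa>) * (\<Prod>i=1..s. cell_mass K i (\<kappa> i)))"
  proof (intro sum.cong refl)
    fix \<kappa>
    have "(\<integral>x. F (box_pt K \<kappa>) * (\<Prod>i=1..s. g \<kappa> i (x i)) \<partial>?M) =
        F (box_pt K \<kappa>) * (\<integral>x. (\<Prod>i=1..s. g \<kappa> i (x i)) \<partial>?M)"
      by simp
    also have "(\<integral>x. (\<Prod>i=1..s. g \<kappa> i (x i)) \<partial>?M) = (\<Prod>i=1..s. integral\<^sup>L lebesgue (g \<kappa> i))"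
      by (rule product_integral_prod[OF _ g]) auto
    also have "\<dots> = (\<Prod>i=1..s. cell_mass K i (\<kappa> i))"
      by (intro prod.cong refl) (simp add: interval_density.mass_def[OF interval_density] g_def[abs_def])
    finally show "(\<integral>x. F (box_pt K \<kappa>) * (\<Prod>i=1..s. g \<kappa> i (x i)) \<partial>?M) =
        F (box_pt K \<kappa>) * (\<Prod>i=1..s. cell_mass K i (\<kappa> i))" .
  qed
  finally show "(LINT x:coord_box s a b|?M. F (box_pt K (box_cell K x)) * prod_density s \<phi> x) =
      (\<Sum>\<kappa>\<in>indices K. F (box_pt K \<kappa>) * (\<Prod>i=1..s. cell_mass K i (\<kappa> i)))" .
qed

text \<open>The constraint factorises over the coordinates: those outside \<open>u\<close>
  contribute the total mass 1, those in \<open>u\<close> a value of the distribution function. The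
  result is the volume of the box whose local discrepancy is taken.\<close>

lemma sum_cell_masses:
  assumes "u \<subseteq> {1..s}" "J \<in> u \<rightarrow> {..<K}"
  shows "(\<Sum>\<kappa>\<in>indices K. (\<Prod>i=1..s. cell_mass K i (\<kappa> i)) * of_bool (\<forall>i\<in>u. \<kappa> i \<le> J i)) =
    (\<Prod>i\<in>u. distr_fun (a i) (\<phi> i) (grid_pt (a i) (b i) K (Suc (J i))))"
proof -
  have "of_bool (\<forall>i\<in>u. \<kappa> i \<le> J i) = (\<Prod>i=1..s. of_bool (i \<in> u \<longrightarrow> \<kappa> i \<le> J i) :: real)" for \<kappa>
    using assms(1) by (auto simp: of_bool_def intro!: prod.neutral[symmetric] prod_zero)
  then have "(\<Sum>\<kappa>\<in>indices K. (\<Prod>i=1..s. cell_mass K i (\<kappa> i)) * of_bool (\<forall>i\<in>u. \<kappa> i \<le> J i)) =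
      (\<Sum>\<kappa>\<in>indices K. \<Prod>i=1..s. cell_mass K i (\<kappa> i) * of_bool (i \<in> u \<longrightarrow> \<kappa> i \<le> J i))"
    by (simp only: prod.distrib)
  also have "\<dots> = (\<Prod>i=1..s. \<Sum>j\<le>K. cell_mass K i j * of_bool (i \<in> u \<longrightarrow> j \<le> J i))"
    by (rule prod_sum_PiE[symmetric]) auto
  also have "\<dots> = (\<Prod>i=1..s. if i \<in> u then distr_fun (a i) (\<phi> i) (grid_pt (a i) (b i) K (Suc (J i))) else 1)"
  proof (intro prod.cong refl)
    fix i assume i: "i \<in> {1..s}"
    show "(\<Sum>j\<le>K. cell_mass K i j * of_bool (i \<in> u \<longrightarrow> j \<le> J i)) =
        (if i \<in> u then distr_fun (a i) (\<phi> i) (grid_pt (a i) (b i) K (Suc (J i))) else 1)"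
    proof (cases "i \<in> u")
      case True
      then have J: "J i < K" using assms(2) by auto
      have "(\<Sum>j\<le>K. cell_mass K i j * of_bool (i \<in> u \<longrightarrow> j \<le> J i)) = (\<Sum>j\<le>J i. cell_mass K i j)"
        using True J by (intro sum.mono_neutral_cong_right) auto
      then show ?thesis
        using True interval_density.sum_mass_eq_distr_fun[OF interval_density[OF i] J] by simp
    qed (simp add: interval_density.sum_mass_total[OF interval_density[OF i]])
  qed
  also have "\<dots> = (\<Prod>i\<in>u. distr_fun (a i) (\<phi> i) (grid_pt (a i) (b i) K (Suc (J i))))"
    using assms(1) by (intro prod.mono_neutral_cong_right) auto
  finally show ?thesis .
qed

lemma inv_distr_nth:
  "i \<in> {1..s} \<Longrightarrow> inv_distr s a b \<phi> y i = the_inv_into {a i..b i} (distr_fun (a i) (\<phi> i)) (y i)"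
  by (simp add: inv_distr_def)

lemma inv_distr_mem:
  assumes "\<And>i. i \<in> {1..s} \<Longrightarrow> y i \<in> {0..1}"
  shows "inv_distr s a b \<phi> y \<in> coord_box s a b"
proof -
  have "inv_distr s a b \<phi> y i \<in> {a i..b i}" if "i \<in> {1..s}" for i
    unfolding inv_distr_nth[OF that]
    using interval_density.inverse_distr_fun(1)[OF interval_density[OF that] assms[OF that]] .
  moreover have "inv_distr s a b \<phi> y \<in> extensional {1..s}" by (simp add: inv_distr_def)
  ultimately show ?thesis unfolding coord_box_def PiE_iff by blast
qed

text \<open>Translates a bound on the cell index into the strict inequality of the local
  discrepancy; the cells being open on the right matches that strictness.\<close>

lemma cell_inv_distr_le_iff:
  assumes "i \<in> {1..s}" "y i \<in> {0..1}" "j < K"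
  shows "cell (a i) (b i) K (inv_distr s a b \<phi> y i) \<le> j \<longleftrightarrow>
    y i < distr_fun (a i) (\<phi> i) (grid_pt (a i) (b i) K (Suc j))"
proof -
  interpret interval_density "a i" "b i" "\<phi> i" by (rule interval_density[OF assms(1)])
  have "cell (a i) (b i) K (inv_distr s a b \<phi> y i) \<le> j \<longleftrightarrow>
      inv_distr s a b \<phi> y i < grid_pt (a i) (b i) K (Suc j)"
    using assms less inverse_distr_fun(1)[OF assms(2)]
    by (intro cell_le_iff) (auto simp: inv_distr_nth)
  also have "\<dots> \<longleftrightarrow> y i < distr_fun (a i) (\<phi> i) (grid_pt (a i) (b i) K (Suc j))"
    using distr_fun_less_iff[OF inverse_distr_fun(1)[OF assms(2)] grid_pt_mem[of "a i" "b i" K "Suc j"]]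
      assms less
    by (simp add: inv_distr_nth inverse_distr_fun(2)[OF assms(2)])
  finally show ?thesis .
qed

text \<open>Quadrature rule and integral of a step function are two discrete measures on the same
  grid, so their difference is one weighted sum to which \<open>grid_summation_bound\<close>
  applies; the weighted counts there become local discrepancies.\<close>

lemma step_function_error:
  assumes F: "mixed_derivs_exist s a b F"
    and S: "\<forall>u\<subseteq>{1..s}. \<forall>x\<in>coord_box s a b. \<bar>mixed_deriv a b u F x\<bar> \<le> S u"
    and "0 < K" "0 < N"
    and y: "\<And>n i. n < N \<Longrightarrow> i \<in> {1..s} \<Longrightarrow> y n i \<in> {0..1}"
    and D: "\<And>u z. u \<subseteq> {1..s} \<Longrightarrow> (\<And>i. i \<in> u \<Longrightarrow> z i \<in> {0..1}) \<Longrightarrow>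
      \<bar>real (card {n\<in>{..<N}. \<forall>i\<in>u. y n i < z i}) / real N - (\<Prod>i\<in>u. z i)\<bar> \<le> D u"
  shows "\<bar>1 / real N * (\<Sum>n<N. F (box_pt K (box_cell K (inv_distr s a b \<phi> (y n)))))
      - (LINT x:coord_box s a b|PiM {1..s} (\<lambda>_. lebesgue). F (box_pt K (box_cell K x)) * prod_density s \<phi> x)\<bar>
    \<le> (\<Sum>u\<in>Pow {1..s}. S u * (\<Prod>i\<in>u. b i - a i) * D u)"
proof -
  \<comment> \<open>A disjoint union of the net points, with weight \<open>1 / real N\<close>, and
    the grid cells, with the negative of their mass as weight.\<close>
  define \<Omega> where "\<Omega> = {..<N} <+> indices K"
  define w where "w = case_sum (\<lambda>_::nat. 1 / real N) (\<lambda>\<kappa>. - (\<Prod>i=1..s. cell_mass K i (\<kappa> i)))"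
  define idx where "idx = case_sum (\<lambda>n. box_cell K (inv_distr s a b \<phi> (y n))) (\<lambda>\<kappa>. \<kappa>)"
  define M where "M u = S u * (\<Prod>i\<in>u. (b i - a i) / real K)" for u
  have fin: "finite (indices K)" by (intro finite_PiE) auto
  have sum_\<Omega>: "(\<Sum>\<omega>\<in>\<Omega>. w \<omega> * g (idx \<omega>)) =
      1 / real N * (\<Sum>n<N. g (box_cell K (inv_distr s a b \<phi> (y n))))
        - (\<Sum>\<kappa>\<in>indices K. (\<Prod>i=1..s. cell_mass K i (\<kappa> i)) * g \<kappa>)" for g
    unfolding \<Omega>_def w_def idx_def sum.Plus[OF finite_lessThan fin]
    by (simp only: o_def sum.case sum_distrib_left mult_minus_left sum_negf diff_conv_add_uminus)
  have "\<bar>\<Sum>\<omega>\<in>\<Omega>. w \<omega> * F (box_pt K (idx \<omega>))\<bar> \<le> (\<Sum>u\<in>Pow {1..s}. real K ^ card u * M u * D u)"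
  proof (rule grid_summation_bound[where \<kappa> = idx and G = "\<lambda>\<kappa>. F (box_pt K \<kappa>)" and s = s])
    show "s \<le> s" ..
  next
    fix \<omega> assume "\<omega> \<in> \<Omega>"
    then show "idx \<omega> \<in> indices K"
    proof (cases \<omega>)
      case (Inl n)
      with \<open>\<omega> \<in> \<Omega>\<close> have "n \<in> {..<N}" unfolding \<Omega>_def by blast
      then have "n < N" by simp
      then have "inv_distr s a b \<phi> (y n) \<in> coord_box s a b" by (intro inv_distr_mem y)
      then have "box_cell K (inv_distr s a b \<phi> (y n)) \<in> indices K" by (rule box_cell_indices)
      then show ?thesis unfolding Inl idx_def sum.case .
    next
      case (Inr \<kappa>)
      with \<open>\<omega> \<in> \<Omega>\<close> have "\<kappa> \<in> indices K" unfolding \<Omega>_def by blast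
      then show ?thesis unfolding Inr idx_def sum.case .
    qed
  next
    fix u J x assume *: "u \<subseteq> {1..s}" "J \<in> u \<rightarrow> {..<K}" "x \<in> indices K"
    let ?l = "\<lambda>i. grid_pt (a i) (b i) K (J i)" and ?h = "\<lambda>i. grid_pt (a i) (b i) K (Suc (J i))"
    have fin: "finite u" using *(1) finite_subset by auto
    have lh: "a j \<le> ?l j \<and> ?l j \<le> ?h j \<and> ?h j \<le> b j" if "j \<in> u" for j
    proof -
      have j: "j \<in> {1..s}" "J j < K" using that * by auto
      have "?l j \<in> {a j..b j}" "?h j \<in> {a j..b j}"
        using grid_pt_mem[OF a_less_b[OF j(1)] \<open>0 < K\<close>] j(2) by simp_all
      moreover have "?l j \<le> ?h j"
        unfolding grid_pt_def using a_less_b[OF j(1)]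
        by (intro add_left_mono divide_right_mono mult_left_mono) auto
      ultimately show ?thesis unfolding atLeastAtMost_iff by blast
    qed
    have eq: "diffs J (\<lambda>i. Suc (J i)) (sorted_list_of_set u) (\<lambda>\<kappa>. F (box_pt K \<kappa>)) x =
        diffs ?l ?h (sorted_list_of_set u) F (box_pt K x)"
    proof (rule diffs_comp)
      fix i and x :: "nat \<Rightarrow> nat" assume "i \<in> set (sorted_list_of_set u)"
      then have "i \<in> {1..s}" using *(1) fin by auto
      then show "box_pt K (x(i := Suc (J i))) = (box_pt K x)(i := ?h i)"
        and "box_pt K (x(i := J i)) = (box_pt K x)(i := ?l i)"
        by (rule box_pt_upd)+
    qed
    have "(\<Prod>i\<in>u. ?h i - ?l i) = (\<Prod>i\<in>u. (b i - a i) / real K)"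
      by (intro prod.cong refl grid_pt_diff)
    moreover have "\<bar>diffs ?l ?h (sorted_list_of_set u) F (box_pt K x)\<bar> \<le> S u * (\<Prod>i\<in>u. ?h i - ?l i)"
    proof (rule mixed_diffs_bound[OF F *(1) box_pt_mem[OF \<open>0 < K\<close> *(3)] lh])
      show "\<bar>mixed_deriv a b u F z\<bar> \<le> S u" if "z \<in> coord_box s a b" for z
        using S *(1) that by blast
    qed
    ultimately show "\<bar>diffs J (\<lambda>i. Suc (J i)) (sorted_list_of_set u) (\<lambda>\<kappa>. F (box_pt K \<kappa>)) x\<bar> \<le> M u"
      unfolding eq M_def by (simp only:)
  next
    fix u J assume *: "u \<subseteq> {1..s}" "J \<in> u \<rightarrow> {..<K}"
    let ?z = "\<lambda>i. distr_fun (a i) (\<phi> i) (grid_pt (a i) (b i) K (Suc (J i)))"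
    have z: "?z i \<in> {0..1}" if "i \<in> u" for i
    proof -
      have i: "i \<in> {1..s}" "J i < K" using that * by auto
      then have "grid_pt (a i) (b i) K (Suc (J i)) \<in> {a i..b i}"
        by (intro grid_pt_mem a_less_b) auto
      then show ?thesis
        by (rule interval_density.distr_fun_mem[OF interval_density[OF i(1)]])
    qed
    have "(\<Sum>\<omega>\<in>\<Omega>. w \<omega> * of_bool (\<forall>i\<in>u. idx \<omega> i \<le> J i)) =
        1 / real N * (\<Sum>n<N. of_bool (\<forall>i\<in>u. box_cell K (inv_distr s a b \<phi> (y n)) i \<le> J i))
          - (\<Prod>i\<in>u. ?z i)"
      unfolding sum_\<Omega>[of "\<lambda>\<kappa>. of_bool (\<forall>i\<in>u. \<kappa> i \<le> J i)"] sum_cell_masses[OF *] ..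
    also have "(\<Sum>n<N. of_bool (\<forall>i\<in>u. box_cell K (inv_distr s a b \<phi> (y n)) i \<le> J i)) =
        (\<Sum>n<N. of_bool (\<forall>i\<in>u. y n i < ?z i) :: real)"
    proof (intro sum.cong refl arg_cong[where f = of_bool] ball_cong)
      fix n i assume "n \<in> {..<N}" "i \<in> u"
      then have "n < N" "i \<in> {1..s}" "J i < K" using * by auto
      then show "box_cell K (inv_distr s a b \<phi> (y n)) i \<le> J i \<longleftrightarrow> y n i < ?z i"
        using cell_inv_distr_le_iff[of i "y n" "J i" K] y[of n i] by (simp add: box_cell_def)
    qed
    also have "\<dots> = real (card {n\<in>{..<N}. \<forall>i\<in>u. y n i < ?z i})"
      by (simp add: Int_def)
    finally have eq: "(\<Sum>\<omega>\<in>\<Omega>. w \<omega> * of_bool (\<forall>i\<in>u. idx \<omega> i \<le> J i)) =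
        real (card {n\<in>{..<N}. \<forall>i\<in>u. y n i < ?z i}) / real N - (\<Prod>i\<in>u. ?z i)"
      by (simp only: mult_1 times_divide_eq_left)
    show "\<bar>\<Sum>\<omega>\<in>\<Omega>. w \<omega> * of_bool (\<forall>i\<in>u. idx \<omega> i \<le> J i)\<bar> \<le> D u"
      unfolding eq by (rule D[OF *(1) z])
  next
    show "idx \<omega> i = K" if "i \<in> {s<..s}" for \<omega> i
      using that by simp
  qed
  \<comment> \<open>The number of grid differences cancels against the side lengths
    \<open>(b i - a i) / real K\<close>, which makes the bound independent of
    \<open>K\<close>.\<close>
  also have "(\<Sum>u\<in>Pow {1..s}. real K ^ card u * M u * D u) =
      (\<Sum>u\<in>Pow {1..s}. S u * (\<Prod>i\<in>u. b i - a i) * D u)"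
  proof (intro sum.cong refl)
    fix u :: "nat set"
    have cancel: "c * (x * (y / c)) * z = x * y * z" if "c \<noteq> 0" for c x y z :: real
      using that by (simp only: times_divide_eq_right nonzero_mult_div_cancel_left mult.assoc not_False_eq_True)
    have "real K ^ card u \<noteq> 0" using \<open>0 < K\<close> by simp
    then show "real K ^ card u * M u * D u = S u * (\<Prod>i\<in>u. b i - a i) * D u"
      unfolding M_def prod_dividef prod_constant by (rule cancel)
  qed
  also have "(\<Sum>\<omega>\<in>\<Omega>. w \<omega> * F (box_pt K (idx \<omega>))) =
      1 / real N * (\<Sum>n<N. F (box_pt K (box_cell K (inv_distr s a b \<phi> (y n)))))
      - (LINT x:coord_box s a b|PiM {1..s} (\<lambda>_. lebesgue). F (box_pt K (box_cell K x)) * prod_density s \<phi> x)"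
    unfolding sum_\<Omega>[of "\<lambda>\<kappa>. F (box_pt K \<kappa>)"] step_function_integral(2)[of F K]
    by (simp only: mult.commute)
  finally show ?thesis .
qed

lemma step_function_tendsto:
  assumes F: "mixed_derivs_exist s a b F"
    and S: "\<forall>u\<subseteq>{1..s}. \<forall>x\<in>coord_box s a b. \<bar>mixed_deriv a b u F x\<bar> \<le> S u"
    and x: "x \<in> coord_box s a b"
  shows "(\<lambda>K. F (box_pt (Suc K) (box_cell (Suc K) x))) \<longlonglongrightarrow> F x"
proof -
  define C where "C = (\<Sum>i=1..s. S {i} * (b i - a i))"
  have S0: "0 \<le> S {i}" if "i \<in> {1..s}" for i
    using order_trans[OF abs_ge_zero S[rule_format, OF _ x, of "{i}"]] that by simp
  have bound: "\<bar>F (box_pt (Suc K) (box_cell (Suc K) x)) - F x\<bar> \<le> C * inverse (real (Suc K))" for K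
  proof -
    have "\<bar>F (box_pt (Suc K) (box_cell (Suc K) x)) - F x\<bar> \<le>
        (\<Sum>i=1..s. S {i} * \<bar>box_pt (Suc K) (box_cell (Suc K) x) i - x i\<bar>)"
    proof (rule mixed_derivs_exist_lipschitz[OF F _ _ x])
      show "\<bar>mixed_deriv a b {i} F z\<bar> \<le> S {i}" if "i \<in> {1..s}" "z \<in> coord_box s a b" for i z
        using that S by simp
      show "box_pt (Suc K) (box_cell (Suc K) x) \<in> coord_box s a b"
        by (rule box_pt_mem[OF zero_less_Suc box_cell_indices[OF x]])
    qed
    also have "\<dots> \<le> (\<Sum>i=1..s. S {i} * ((b i - a i) / real (Suc K)))"
    proof (intro sum_mono mult_left_mono S0)
      fix i assume i: "i \<in> {1..s}"
      show "\<bar>box_pt (Suc K) (box_cell (Suc K) x) i - x i\<bar> \<le> (b i - a i) / real (Suc K)"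
        using grid_pt_cell[OF a_less_b[OF i] zero_less_Suc coord_box_nth[OF x i], of K] i
        by (simp add: box_pt_def box_cell_def abs_minus_commute)
    qed
    also have "\<dots> = C * inverse (real (Suc K))"
      by (simp add: C_def sum_distrib_right divide_inverse mult.assoc)
    finally show ?thesis .
  qed
  have "(\<lambda>K. C * inverse (real (Suc K))) \<longlonglongrightarrow> C * 0"
    by (rule tendsto_mult_left[OF LIMSEQ_inverse_real_of_nat])
  then have lim: "(\<lambda>K. C * inverse (real (Suc K))) \<longlonglongrightarrow> 0" by simp
  have "(\<lambda>K. F (box_pt (Suc K) (box_cell (Suc K) x)) - F x) \<longlonglongrightarrow> 0"
    by (rule Lim_null_comparison[OF _ lim]) (simp only: real_norm_def bound always_eventually simp_thms)
  then show ?thesis by (simp add: LIM_zero_iff)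
qed

text \<open>Dominated convergence: the Lipschitz estimate gives pointwise convergence, and
  \<open>S {}\<close> times the density is a majorant.\<close>

lemma step_function_integral_tendsto:
  assumes F: "mixed_derivs_exist s a b F"
    and S: "\<forall>u\<subseteq>{1..s}. \<forall>x\<in>coord_box s a b. \<bar>mixed_deriv a b u F x\<bar> \<le> S u"
  shows "(\<lambda>K. LINT x:coord_box s a b|PiM {1..s} (\<lambda>_. lebesgue).
      F (box_pt (Suc K) (box_cell (Suc K) x)) * prod_density s \<phi> x)
    \<longlonglongrightarrow> (LINT x:coord_box s a b|PiM {1..s} (\<lambda>_. lebesgue). F x * prod_density s \<phi> x)"
proof -
  let ?M = "PiM {1..s} (\<lambda>_. lebesgue :: real measure)"
  let ?I = "indicator (coord_box s a b)"
  let ?g = "\<lambda>K x. ?I x *\<^sub>R (F (box_pt (Suc K) (box_cell (Suc K) x)) * prod_density s \<phi> x)"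
  let ?f = "\<lambda>x. ?I x *\<^sub>R (F x * prod_density s \<phi> x)"
  have conv: "(\<lambda>K. ?g K x) \<longlonglongrightarrow> ?f x" for x
  proof (cases "x \<in> coord_box s a b")
    case True
    then have "(\<lambda>K. F (box_pt (Suc K) (box_cell (Suc K) x))) \<longlonglongrightarrow> F x"
      by (rule step_function_tendsto[OF F S])
    then show ?thesis by (intro tendsto_scaleR tendsto_mult tendsto_const)
  qed simp
  have int: "integrable ?M (?g K)" for K
    using step_function_integral(1)[of F "Suc K"] unfolding set_integrable_def .
  \<comment> \<open>The step function of the constant 1 is the density itself.\<close>
  have "set_integrable ?M (coord_box s a b) (prod_density s \<phi>)"
    using step_function_integral(1)[of "\<lambda>_. 1" 1] by simp
  then have "integrable ?M (\<lambda>x. S {} * norm (?I x *\<^sub>R prod_density s \<phi> x))"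
    unfolding set_integrable_def by (intro integrable_mult_right integrable_norm)
  then show ?thesis
    unfolding set_lebesgue_integral_def
  proof (rule integral_dominated_convergence[rotated 2])
    show "?g K \<in> borel_measurable ?M" for K
      using int by (rule borel_measurable_integrable)
    \<comment> \<open>Measurability of the integrand is obtained as that of a pointwise limit of
      measurable step functions.\<close>
    then show "?f \<in> borel_measurable ?M"
      by (rule borel_measurable_LIMSEQ_metric) (rule conv)
    show "AE x in ?M. (\<lambda>K. ?g K x) \<longlonglongrightarrow> ?f x" by (simp only: conv AE_I2)
    show "AE x in ?M. norm (?g K x) \<le> S {} * norm (?I x *\<^sub>R prod_density s \<phi> x)" for K
    proof (rule AE_I2)
      fix x
      show "norm (?g K x) \<le> S {} * norm (?I x *\<^sub>R prod_density s \<phi> x)"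
      proof (cases "x \<in> coord_box s a b")
        case True
        then have "\<bar>F (box_pt (Suc K) (box_cell (Suc K) x))\<bar> \<le> S {}"
          using S box_pt_mem[OF zero_less_Suc box_cell_indices[OF True]]
          by (metis empty_subsetI mixed_deriv_empty)
        then show ?thesis using True by (simp add: abs_mult mult_right_mono)
      qed simp
    qed
  qed
qed

theorem koksma_hlawka:
  assumes F: "mixed_derivs_exist s a b F"
    and S: "\<forall>u\<subseteq>{1..s}. \<forall>x\<in>coord_box s a b. \<bar>mixed_deriv a b u F x\<bar> \<le> S u"
    and "0 < N"
    and y: "\<And>n i. n < N \<Longrightarrow> i \<in> {1..s} \<Longrightarrow> y n i \<in> {0..1}"
    and D: "\<And>u z. u \<subseteq> {1..s} \<Longrightarrow> u \<noteq> {} \<Longrightarrow> (\<And>i. i \<in> u \<Longrightarrow> z i \<in> {0..1}) \<Longrightarrow>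
      \<bar>real (card {n\<in>{..<N}. \<forall>i\<in>u. y n i < z i}) / real N - (\<Prod>i\<in>u. z i)\<bar> \<le> D u"
  shows "\<bar>1 / real N * (\<Sum>n<N. F (inv_distr s a b \<phi> (y n)))
      - (LINT x:coord_box s a b|PiM {1..s} (\<lambda>_. lebesgue). F x * prod_density s \<phi> x)\<bar>
    \<le> (\<Sum>u\<in>Pow {1..s} - {{}}. S u * (\<Prod>i\<in>u. b i - a i) * D u)"
proof -
  \<comment> \<open>For the empty set both the share of the points and the empty product are 1, so
    its local discrepancy vanishes and its term drops out.\<close>
  define D' where "D' u = (if u = {} then 0 else D u)" for u :: "nat set"
  let ?E = "\<lambda>K. \<bar>1 / real N * (\<Sum>n<N. F (box_pt K (box_cell K (inv_distr s a b \<phi> (y n)))))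
      - (LINT x:coord_box s a b|PiM {1..s} (\<lambda>_. lebesgue). F (box_pt K (box_cell K x)) * prod_density s \<phi> x)\<bar>"
  have bound: "?E (Suc K) \<le> (\<Sum>u\<in>Pow {1..s}. S u * (\<Prod>i\<in>u. b i - a i) * D' u)" for K
  proof (rule step_function_error[OF F S zero_less_Suc \<open>0 < N\<close>])
    fix n i assume "n < N" "i \<in> {1..s}"
    then show "y n i \<in> {0..1}" by (rule y)
  next
    fix u and z :: "nat \<Rightarrow> real" assume u: "u \<subseteq> {1..s}" and z: "\<And>i. i \<in> u \<Longrightarrow> z i \<in> {0..1}"
    show "\<bar>real (card {n\<in>{..<N}. \<forall>i\<in>u. y n i < z i}) / real N - (\<Prod>i\<in>u. z i)\<bar> \<le> D' u"
    proof (cases "u = {}")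
      case True
      then show ?thesis using \<open>0 < N\<close> by (simp add: D'_def)
    next
      case False
      with D[OF u False z] show ?thesis by (simp add: D'_def)
    qed
  qed
  have "(\<lambda>K. \<Sum>n<N. F (box_pt (Suc K) (box_cell (Suc K) (inv_distr s a b \<phi> (y n)))))
      \<longlonglongrightarrow> (\<Sum>n<N. F (inv_distr s a b \<phi> (y n)))"
  proof (rule tendsto_sum)
    fix n assume "n \<in> {..<N}"
    then have "inv_distr s a b \<phi> (y n) \<in> coord_box s a b"
      by (intro inv_distr_mem y) simp_all
    then show "(\<lambda>K. F (box_pt (Suc K) (box_cell (Suc K) (inv_distr s a b \<phi> (y n)))))
        \<longlonglongrightarrow> F (inv_distr s a b \<phi> (y n))"
      by (rule step_function_tendsto[OF F S])
  qed
  note tendsto_rabs[OF tendsto_diff[OF tendsto_mult_left[OF this] step_function_integral_tendsto[OF F S]]]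
  then have lim: "(\<lambda>K. ?E (Suc K)) \<longlonglongrightarrow> \<bar>1 / real N * (\<Sum>n<N. F (inv_distr s a b \<phi> (y n)))
      - (LINT x:coord_box s a b|PiM {1..s} (\<lambda>_. lebesgue). F x * prod_density s \<phi> x)\<bar>"
    .
  have "\<bar>1 / real N * (\<Sum>n<N. F (inv_distr s a b \<phi> (y n)))
      - (LINT x:coord_box s a b|PiM {1..s} (\<lambda>_. lebesgue). F x * prod_density s \<phi> x)\<bar>
    \<le> (\<Sum>u\<in>Pow {1..s}. S u * (\<Prod>i\<in>u. b i - a i) * D' u)"
    by (rule LIMSEQ_le_const2[OF lim]) (use bound in blast)
  also have "\<dots> = (\<Sum>u\<in>Pow {1..s} - {{}}. S u * (\<Prod>i\<in>u. b i - a i) * D u)"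
    by (rule sum.mono_neutral_cong_right) (auto simp: D'_def)
  finally show ?thesis .
qed

end

subsection \<open>The error bounds\<close>

text \<open>The norm involves all subsets while the error sums over the non-empty ones, hence two
  index sets. The exponents at which \<open>lp_sum\<close> is a maximum are treated apart, since
  Young's inequality is used for finite exponents above 1.\<close>

lemma holder_lp_sum:
  assumes "1 \<le> p" "1 \<le> q" and pq: "1 / p + 1 / q = 1"
    and "finite A" "B \<subseteq> A" "B \<noteq> {}"
    and f: "\<And>u. u \<in> A \<Longrightarrow> 0 \<le> f u" and g: "\<And>u. u \<in> B \<Longrightarrow> 0 \<le> g u"
    and norm: "lp_sum p A f \<le> 1"
  shows "(\<Sum>u\<in>B. f u * g u) \<le> lp_sum q B g"
proof -
  have "finite B" using assms(4,5) finite_subset by auto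
  consider "p = \<infinity>" | "q = \<infinity>" | p' q' where "p = ereal p'" "q = ereal q'"
    using \<open>1 \<le> p\<close> \<open>1 \<le> q\<close> by (cases p; cases q) auto
  then show ?thesis
  proof cases
    case 1
    then have "1 / q = 1" using pq by simp
    then have "q = 1" using \<open>1 \<le> q\<close> by (cases q) (auto simp: one_ereal_def)
    have "f u \<le> 1" if "u \<in> B" for u
    proof -
      have "f u \<le> Max (f ` A)" using that assms(4,5) by (intro Max_ge) auto
      then show ?thesis using norm 1 by (simp add: lp_sum_def)
    qed
    then have "(\<Sum>u\<in>B. f u * g u) \<le> (\<Sum>u\<in>B. 1 * g u)"
      by (intro sum_mono mult_right_mono g)
    also have "\<dots> = lp_sum q B g"
      using g by (simp add: lp_sum_def \<open>q = 1\<close> sum_nonneg)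
    finally show ?thesis .
  next
    case 2
    then have "1 / p = 1" using pq by simp
    then have "p = 1" using \<open>1 \<le> p\<close> by (cases p) (auto simp: one_ereal_def)
    then have "(\<Sum>u\<in>A. f u) \<le> 1"
      using norm f by (simp add: lp_sum_def sum_nonneg)
    moreover have "(\<Sum>u\<in>B. f u) \<le> (\<Sum>u\<in>A. f u)"
      using assms(4,5) f by (intro sum_mono2) auto
    ultimately have f1: "(\<Sum>u\<in>B. f u) \<le> 1" by linarith
    have Max: "g u \<le> Max (g ` B)" if "u \<in> B" for u
      using that \<open>finite B\<close> by (intro Max_ge) auto
    have "0 \<le> Max (g ` B)" using Max g \<open>B \<noteq> {}\<close> by (meson all_not_in_conv order_trans)
    have "(\<Sum>u\<in>B. f u * g u) \<le> (\<Sum>u\<in>B. f u * Max (g ` B))"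
      using assms(5) f by (intro sum_mono mult_left_mono Max) auto
    also have "\<dots> = (\<Sum>u\<in>B. f u) * Max (g ` B)" by (simp add: sum_distrib_right)
    also have "\<dots> \<le> 1 * Max (g ` B)"
      by (rule mult_right_mono[OF f1 \<open>0 \<le> Max (g ` B)\<close>])
    finally show ?thesis by (simp add: lp_sum_def 2)
  next
    case 3
    have "1 \<le> p'" "1 \<le> q'" using \<open>1 \<le> p\<close> \<open>1 \<le> q\<close> 3 by (auto simp: one_ereal_def)
    moreover have pq': "1 / p' + 1 / q' = 1"
      using pq calculation by (simp add: 3 one_ereal_def)
    moreover have "0 < 1 / p'" "0 < 1 / q'" using calculation by auto
    ultimately have p': "1 < p'" and q': "1 < q'"
      using divide_less_eq_1_pos[of p' 1] divide_less_eq_1_pos[of q' 1] by linarith+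
    have "(\<Sum>u\<in>A. f u powr p') = ((\<Sum>u\<in>A. f u powr p') powr (1 / p')) powr p'"
      using p' by (simp add: powr_powr sum_nonneg)
    also have "\<dots> \<le> 1 powr p'"
      using norm p' by (intro powr_mono2) (auto simp: lp_sum_def 3)
    finally have "(\<Sum>u\<in>A. f u powr p') \<le> 1" by simp
    moreover have "(\<Sum>u\<in>B. f u powr p') \<le> (\<Sum>u\<in>A. f u powr p')"
      using assms(4,5) by (intro sum_mono2) auto
    ultimately have f1: "(\<Sum>u\<in>B. f u powr p') \<le> 1" by linarith
    define T where "T = (\<Sum>u\<in>B. g u powr q')"
    define G where "G = T powr (1 / q')"
    have "0 \<le> T" by (simp add: T_def sum_nonneg)
    have G: "lp_sum q B g = G" by (simp add: lp_sum_def 3 G_def T_def)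
    show ?thesis
    \<comment> \<open>The general case divides by \<open>G\<close>, so a vanishing \<open>g\<close>
      is dealt with first.\<close>
    proof (cases "T = 0")
      case True
      then have "\<forall>u\<in>B. g u powr q' = 0"
        unfolding T_def using \<open>finite B\<close> by (subst (asm) sum_nonneg_eq_0_iff) auto
      then have "(\<Sum>u\<in>B. f u * g u) = 0" by (intro sum.neutral) auto
      then show ?thesis by (simp add: G G_def)
    next
      case False
      then have "0 < G" using \<open>0 \<le> T\<close> by (simp add: G_def)
      have GT: "G powr q' = T" using \<open>0 \<le> T\<close> q' by (simp add: G_def powr_powr)
      \<comment> \<open>Young's inequality term by term, after normalising \<open>g\<close> so that
        both power sums are at most 1.\<close>
      have "(\<Sum>u\<in>B. f u * (g u / G)) \<le> (\<Sum>u\<in>B. f u powr p' / p' + (g u / G) powr q' / q')"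
        using assms(5) f g p' q' pq' \<open>0 < G\<close> by (intro sum_mono Youngs_inequality) auto
      also have "\<dots> = (\<Sum>u\<in>B. f u powr p') / p' + (\<Sum>u\<in>B. (g u / G) powr q') / q'"
        by (simp add: sum.distrib sum_divide_distrib)
      also have "(\<Sum>u\<in>B. (g u / G) powr q') = (\<Sum>u\<in>B. g u powr q' / T)"
        using g \<open>0 < G\<close> by (intro sum.cong refl) (simp add: powr_divide GT)
      also have "\<dots> = 1" using False by (simp add: sum_divide_distrib[symmetric] T_def)
      also have "(\<Sum>u\<in>B. f u powr p') / p' + 1 / q' \<le> 1 / p' + 1 / q'"
        using f1 p' by (intro add_right_mono divide_right_mono) auto
      finally have "(\<Sum>u\<in>B. f u * g u) / G \<le> 1"
        using pq' by (simp add: sum_divide_distrib)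
      then show ?thesis using \<open>0 < G\<close> by (simp add: G divide_le_eq)
    qed
  qed
qed

text \<open>Hoelder's inequality on a singleton with the constant 1 treats finite and infinite
  \<open>p\<close> at once.\<close>

lemma lp_sum_le_1_imp_le_1:
  assumes "1 \<le> p" "1 \<le> q" "1 / p + 1 / q = 1" "finite A"
    and f: "\<And>u. u \<in> A \<Longrightarrow> 0 \<le> f u" and norm: "lp_sum p A f \<le> 1" and u: "u \<in> A"
  shows "f u \<le> 1"
proof -
  have "(\<Sum>u\<in>{u}. f u * 1) \<le> lp_sum q {u} (\<lambda>_. 1)"
    by (rule holder_lp_sum[OF assms(1-4) _ _ f _ norm]) (use u in auto)
  also have "\<dots> = 1" by (simp add: lp_sum_def)
  finally show ?thesis by simp
qed

text \<open>The maximum of \<open>x ^ k * exp (- r x)\<close> is attained at \<open>x = k / r\<close>.\<close>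

lemma power_le_exp:
  fixes x r :: real
  assumes "0 \<le> x" "0 < r" "0 < k"
  shows "x ^ k \<le> (real k / (exp 1 * r)) ^ k * exp (r * x)"
proof -
  define y where "y = r * x / real k"
  have y: "y \<le> exp y / exp 1"
    using exp_ge_add_one_self[of "y - 1"] by (simp add: exp_diff)
  have "x = real k / r * y" using assms by (simp add: y_def)
  also have "\<dots> \<le> real k / r * (exp y / exp 1)"
    using assms by (intro mult_left_mono y) auto
  also have "\<dots> = real k / (exp 1 * r) * exp y" by simp
  finally have "x ^ k \<le> (real k / (exp 1 * r) * exp y) ^ k"
    using assms by (intro power_mono) auto
  also have "\<dots> = (real k / (exp 1 * r)) ^ k * exp (real k * y)"
    by (simp only: power_mult_distrib exp_of_nat_mult)
  also have "real k * y = r * x" using assms by (simp add: y_def)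
  finally show ?thesis .
qed

lemma sum_le_suminf_Suc:
  fixes y :: "nat \<Rightarrow> real"
  assumes "summable (\<lambda>i. y (i + B + 1))" "\<And>i. 1 \<le> i \<Longrightarrow> 0 \<le> y i"
  shows "(\<Sum>i\<in>{B<..r}. y i) \<le> (\<Sum>i. y (i + B + 1))"
proof -
  have "(\<Sum>i\<in>{B<..r}. y i) = (\<Sum>i<r - B. y (i + B + 1))"
    by (rule sum.reindex_bij_witness[where i = "\<lambda>i. i + B + 1" and j = "\<lambda>i. i - B - 1"]) auto
  also have "\<dots> \<le> (\<Sum>i. y (i + B + 1))"
    using assms by (intro sum_le_suminf) auto
  finally show ?thesis .
qed

text \<open>With K = Y / \<epsilon> >= 1, where Y is the full sum, a factor with index up to
  \<open>B\<close> satisfies 1 + x y <= K (1 + x y / K) <= K exp(x y / K); division by K reduces the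
  sum of these exponents to at most \<epsilon> x. Later factors are bounded by exp(x y), and their
  sum is small already. Each block thus contributes exp(\<epsilon> x).\<close>

lemma prod_one_plus_le_power_mult_exp:
  fixes y :: "nat \<Rightarrow> real"
  assumes y: "\<And>i. 1 \<le> i \<Longrightarrow> 0 \<le> y i" and summable: "summable (\<lambda>i. y (i + 1))"
    and "0 < \<epsilon>" "0 \<le> x"
    and K: "1 \<le> (\<Sum>i. y (i + 1)) / \<epsilon>" and tail: "(\<Sum>i. y (i + B + 1)) \<le> \<epsilon>"
  shows "(\<Prod>i=1..s. 1 + x * y i) \<le> ((\<Sum>i. y (i + 1)) / \<epsilon>) ^ B * exp (2 * \<epsilon> * x)"
proof -
  define Y where "Y = (\<Sum>i. y (i + 1))"
  define K where "K = Y / \<epsilon>"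
  have "1 \<le> K" using K by (simp add: K_def Y_def)
  \<comment> \<open>The dimension may be smaller than \<open>B\<close>; then K^r <= K^B because K >=
    1.\<close>
  define r where "r = min s B"
  have split: "{1..s} = {0<..r} \<union> {B<..s}" "{0<..r} \<inter> {B<..s} = {}" by (auto simp: r_def)
  have "(\<Prod>i\<in>{0<..r}. 1 + x * y i) \<le> (\<Prod>i\<in>{0<..r}. K * exp (x * y i / K))"
  proof (intro prod_mono conjI)
    fix i assume "i \<in> {0<..r}"
    then have "0 \<le> x * y i" using y \<open>0 \<le> x\<close> by simp
    then show "0 \<le> 1 + x * y i" by simp
    have "1 + x * y i \<le> K + x * y i" using \<open>1 \<le> K\<close> by simp
    also have "\<dots> = K * (1 + x * y i / K)" using \<open>1 \<le> K\<close> by (simp add: field_simps)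
    also have "\<dots> \<le> K * exp (x * y i / K)"
      using \<open>1 \<le> K\<close> by (intro mult_left_mono exp_ge_add_one_self) auto
    finally show "1 + x * y i \<le> K * exp (x * y i / K)" .
  qed
  also have "\<dots> = K ^ r * exp (x * (\<Sum>i\<in>{0<..r}. y i) / K)"
    by (simp add: prod.distrib exp_sum[symmetric] sum_divide_distrib sum_distrib_left)
  also have "\<dots> \<le> K ^ B * exp (x * Y / K)"
  proof (intro mult_mono power_increasing)
    have "(\<Sum>i\<in>{0<..r}. y i) \<le> Y"
      using sum_le_suminf_Suc[of y 0 r] y summable by (simp add: Y_def)
    then show "exp (x * (\<Sum>i\<in>{0<..r}. y i) / K) \<le> exp (x * Y / K)"
      using \<open>0 \<le> x\<close> \<open>1 \<le> K\<close> by (simp add: divide_right_mono mult_left_mono)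
  qed (use \<open>1 \<le> K\<close> in \<open>auto simp: r_def\<close>)
  also have "x * Y / K = \<epsilon> * x"
    using \<open>1 \<le> K\<close> \<open>0 < \<epsilon>\<close> by (auto simp: K_def field_simps)
  finally have 1: "(\<Prod>i\<in>{0<..r}. 1 + x * y i) \<le> K ^ B * exp (\<epsilon> * x)" .
  have "(\<Prod>i\<in>{B<..s}. 1 + x * y i) \<le> (\<Prod>i\<in>{B<..s}. exp (x * y i))"
    using y \<open>0 \<le> x\<close> by (intro prod_mono) (auto intro!: add_nonneg_nonneg mult_nonneg_nonneg)
  also have "\<dots> = exp (x * (\<Sum>i\<in>{B<..s}. y i))"
    by (simp add: exp_sum[symmetric] sum_distrib_left)
  also have "\<dots> \<le> exp (\<epsilon> * x)"
  proof -
    have "summable (\<lambda>i. y (i + B + 1))"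
      using summable_ignore_initial_segment[OF summable, of B] by simp
    from sum_le_suminf_Suc[OF this y] have "(\<Sum>i\<in>{B<..s}. y i) \<le> \<epsilon>"
      using tail by (rule order_trans)
    from mult_left_mono[OF this \<open>0 \<le> x\<close>] show ?thesis
      by (simp only: exp_le_cancel_iff mult.commute)
  qed
  finally have 2: "(\<Prod>i\<in>{B<..s}. 1 + x * y i) \<le> exp (\<epsilon> * x)" .
  have "(\<Prod>i=1..s. 1 + x * y i) = (\<Prod>i\<in>{0<..r}. 1 + x * y i) * (\<Prod>i\<in>{B<..s}. 1 + x * y i)"
    unfolding split(1) by (rule prod.union_disjoint) (use split(2) in auto)
  also have "\<dots> \<le> (K ^ B * exp (\<epsilon> * x)) * exp (\<epsilon> * x)"
    using 1 2 \<open>1 \<le> K\<close> y \<open>0 \<le> x\<close> by (intro mult_mono prod_nonneg) auto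
  also have "\<dots> = K ^ B * exp (2 * \<epsilon> * x)" by (simp add: mult_exp_exp mult.assoc algebra_simps)
  finally show ?thesis by (simp add: K_def Y_def)
qed

section \<open>Discrepancy of the projections of a Sobol' net\<close>

text \<open>For i >= 1 this is 2 to the power of the \<open>i\<close>-th summand in the bound on the
  quality parameter, without \<open>c\<close>.\<close>

definition sobol_weight :: "nat \<Rightarrow> real"
  where "sobol_weight i = real i * ld (real i + 1) * ld (ld (real i + 3))"

lemma ld_Suc_ge_1: "1 \<le> i \<Longrightarrow> 1 \<le> ld (real i + 1)"
  by (subst one_le_log_cancel_iff) auto

text \<open>Rests on i + 3 >= 4, so that the inner logarithm is at least 2. It keeps the iterated
  logarithms positive, as needed for cancelling them against powers of 2.\<close>

lemma ld_ld_ge_1: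
  assumes "1 \<le> i"
  shows "1 \<le> ld (ld (real i + 3))"
proof -
  have "2 = ld 4" using log_pow_cancel[of "2 :: real" 2] by simp
  also have "\<dots> \<le> ld (real i + 3)" using assms by simp
  finally show ?thesis by (subst one_le_log_cancel_iff) auto
qed

lemma sobol_weight_pos: "1 \<le> i \<Longrightarrow> 0 < sobol_weight i"
  using ld_Suc_ge_1[of i] ld_ld_ge_1[of i] by (simp add: sobol_weight_def)

lemma powr_sobol_quality:
  assumes "1 \<le> i"
  shows "2 powr (ld (real i) + ld (ld (real i + 1)) + ld (ld (ld (real i + 3))) + c) =
    2 powr c * sobol_weight i"
  using assms ld_Suc_ge_1[OF assms] ld_ld_ge_1[OF assms]
  by (simp add: powr_add sobol_weight_def)

text \<open>Both 2^t and (2 m)^|u| distribute over the coordinates: each receives 2^c times its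
  weight from the former and 2 m from the latter.\<close>

lemma sobol_net_discrepancy:
  assumes "sobol_quality_constant \<mu> c" "1 \<le> m" "u \<subseteq> {1..s}" "u \<noteq> {}"
    and z: "\<And>i. i \<in> u \<Longrightarrow> z i \<in> {0..1}"
  shows "\<bar>real (card {n\<in>{..<2 ^ m}. \<forall>i\<in>u. digital_net m s (sobol_matrix \<mu>) n i < z i}) / real (2 ^ m)
      - (\<Prod>i\<in>u. z i)\<bar> \<le> 3 / 2 ^ m * (\<Prod>i\<in>u. 2 powr (c + 1) * real m * sobol_weight i)"
proof -
  define t where "t = (LEAST t. generates_digital_net t m u (sobol_matrix \<mu>))"
  have fin: "finite u" and "u \<subseteq> {1..}" using assms(3) finite_subset by auto
  \<comment> \<open>The value \<open>m\<close> always qualifies, as it prescribes no rows at all;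
    hence the least value exists and has the property itself.\<close>
  have "generates_digital_net m m u (sobol_matrix \<mu>)"
    using fin by (auto simp: generates_digital_net_def rows_independent_def)
  then have net: "generates_digital_net t m u (sobol_matrix \<mu>)"
    unfolding t_def by (rule LeastI)
  have "real t \<le> (\<Sum>i\<in>u. ld (real i) + ld (ld (real i + 1)) + ld (ld (ld (real i + 3))) + c)"
    using assms(1,2,4) fin \<open>u \<subseteq> {1..}\<close> unfolding t_def sobol_quality_constant_def by blast
  then have "2 powr real t \<le> 2 powr (\<Sum>i\<in>u. ld (real i) + ld (ld (real i + 1)) + ld (ld (ld (real i + 3))) + c)"
    by simp
  also have "\<dots> = (\<Prod>i\<in>u. 2 powr c * sobol_weight i)"
    using assms(3) by (subst powr_sum) (auto intro!: prod.cong powr_sobol_quality fin)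
  finally have t: "2 ^ t \<le> (\<Prod>i\<in>u. 2 powr c * sobol_weight i)" by (simp add: powr_realpow)
  have "\<bar>real (card {n\<in>{..<2 ^ m}. \<forall>i\<in>u. digital_net m s (sobol_matrix \<mu>) n i < z i}) / 2 ^ m
      - (\<Prod>i\<in>u. z i)\<bar> \<le> 3 * 2 ^ t * (2 * real m) ^ card u / 2 ^ m"
    by (rule net_discrepancy[OF assms(3,4,2) net]) (use z in auto)
  also have "\<dots> = 3 / 2 ^ m * (2 ^ t * (2 * real m) ^ card u)" by simp
  also have "\<dots> \<le> 3 / 2 ^ m * ((\<Prod>i\<in>u. 2 powr c * sobol_weight i) * (2 * real m) ^ card u)"
    by (intro mult_left_mono mult_right_mono t) auto
  also have "(\<Prod>i\<in>u. 2 powr c * sobol_weight i) * (2 * real m) ^ card u =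
      (\<Prod>i\<in>u. 2 powr (c + 1) * real m * sobol_weight i)"
  proof -
    have "(2 * real m) ^ card u = (\<Prod>i\<in>u. 2 * real m)" by (rule prod_constant[symmetric])
    then have "(\<Prod>i\<in>u. 2 powr c * sobol_weight i) * (2 * real m) ^ card u =
        (\<Prod>i\<in>u. 2 powr c * sobol_weight i * (2 * real m))"
      by (simp only: prod.distrib)
    also have "\<dots> = (\<Prod>i\<in>u. 2 powr (c + 1) * real m * sobol_weight i)"
      by (intro prod.cong refl) (simp add: powr_add)
    finally show ?thesis .
  qed
  finally show ?thesis by simp
qed

text \<open>Adding the elements of \<open>u\<close> in increasing order writes its weight as a
  telescoping product of ratios, started by \<open>\<gamma> {} = 1\<close>. The ratio that adds
  \<open>i\<close> has its smaller set inside \<open>{1..<i}\<close>, so the maximum bounds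
  it.\<close>

lemma weight_le_prod_max_ratio:
  fixes \<gamma> :: "nat set \<Rightarrow> real"
  assumes pos: "\<And>u. finite u \<Longrightarrow> u \<subseteq> {1..} \<Longrightarrow> 0 < \<gamma> u" and "\<gamma> {} = 1"
    and "finite u" "u \<subseteq> {1..}"
  shows "\<gamma> u \<le> (\<Prod>i\<in>u. MAX v\<in>Pow {1..<i}. \<gamma> (insert i v) / \<gamma> v)"
  using assms(3,4)
proof (induction u rule: finite_linorder_max_induct)
  case empty
  then show ?case using \<open>\<gamma> {} = 1\<close> by simp
next
  case (insert i u)
  have \<gamma>: "0 < \<gamma> u" "0 < \<gamma> (insert i u)" using insert by (auto intro!: pos)
  have "u \<in> Pow {1..<i}" using insert by auto
  then have "\<gamma> (insert i u) / \<gamma> u \<le> (MAX v\<in>Pow {1..<i}. \<gamma> (insert i v) / \<gamma> v)"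
    by (intro Max_ge) auto
  moreover from this have "0 \<le> (MAX v\<in>Pow {1..<i}. \<gamma> (insert i v) / \<gamma> v)"
    by (rule order_trans[rotated]) (use \<gamma> in simp)
  moreover have "\<gamma> u \<le> (\<Prod>i\<in>u. MAX v\<in>Pow {1..<i}. \<gamma> (insert i v) / \<gamma> v)"
    using insert by simp
  ultimately have "\<gamma> (insert i u) / \<gamma> u * \<gamma> u \<le> (MAX v\<in>Pow {1..<i}. \<gamma> (insert i v) / \<gamma> v) *
      (\<Prod>i\<in>u. MAX v\<in>Pow {1..<i}. \<gamma> (insert i v) / \<gamma> v)"
    using \<gamma> by (intro mult_mono) auto
  then show ?case using \<gamma> insert.hyps by (subst prod.insert) auto
qed

text \<open>Bounding each weight by a product over its elements turns the sum over all subsets into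
  the expansion of a product over the coordinates.\<close>

lemma sum_weighted_prod_le:
  fixes \<gamma> :: "nat set \<Rightarrow> real" and z :: "nat \<Rightarrow> real"
  assumes pos: "\<And>u. finite u \<Longrightarrow> u \<subseteq> {1..} \<Longrightarrow> 0 < \<gamma> u"
    and z: "\<And>i. 1 \<le> i \<Longrightarrow> 0 \<le> z i"
  shows "(\<Sum>u\<in>Pow {1..s} - {{}}. \<gamma> u * (\<Prod>i\<in>u. z i)) \<le>
    (\<Prod>i=1..s. 1 + z i * (MAX v\<in>Pow {1..<i}. (\<gamma>({} := 1)) (insert i v) / (\<gamma>({} := 1)) v))"
    (is "_ \<le> (\<Prod>i=1..s. 1 + z i * ?M i)")
proof -
  have pos': "finite u \<Longrightarrow> u \<subseteq> {1..} \<Longrightarrow> 0 < (\<gamma>({} := 1)) u" for u using pos by auto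
  have le: "(\<gamma>({} := 1)) u * (\<Prod>i\<in>u. z i) \<le> (\<Prod>i\<in>u. z i * ?M i)" if u: "u \<subseteq> {1..s}" for u
  proof -
    have fin: "finite u" "u \<subseteq> {1..}" using u finite_subset by auto
    have "(\<gamma>({} := 1)) u * (\<Prod>i\<in>u. z i) \<le> (\<Prod>i\<in>u. ?M i) * (\<Prod>i\<in>u. z i)"
      by (intro mult_right_mono weight_le_prod_max_ratio pos' prod_nonneg) (use fin z in auto)
    then show ?thesis by (simp only: prod.distrib mult.commute)
  qed
  \<comment> \<open>The empty set is outside the range, so giving it the weight 1 changes nothing
    here; its term is added afterwards to complete the expansion.\<close>
  have "(\<Sum>u\<in>Pow {1..s} - {{}}. \<gamma> u * (\<Prod>i\<in>u. z i)) =
      (\<Sum>u\<in>Pow {1..s} - {{}}. (\<gamma>({} := 1)) u * (\<Prod>i\<in>u. z i))"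
    by (intro sum.cong) auto
  also have "\<dots> \<le> (\<Sum>u\<in>Pow {1..s}. (\<gamma>({} := 1)) u * (\<Prod>i\<in>u. z i))"
  proof (rule sum_mono2)
    fix u assume "u \<in> Pow {1..s} - (Pow {1..s} - {{}})"
    then show "0 \<le> (\<gamma>({} := 1)) u * (\<Prod>i\<in>u. z i)" by auto
  qed auto
  also have "\<dots> \<le> (\<Sum>u\<in>Pow {1..s}. \<Prod>i\<in>u. z i * ?M i)"
    by (intro sum_mono le) auto
  also have "\<dots> = (\<Prod>i=1..s. z i * ?M i + 1)"
    by (subst prod_add) simp_all
  finally show ?thesis by (simp only: add.commute)
qed

text \<open>Isolates what the two parts have in common. In \<open>bound\<close>, \<open>f u\<close>
  stands for the supremum of the mixed derivative divided by \<open>\<gamma> u\<close>, so the unit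
  ball of the norm becomes a condition on finitely many numbers.\<close>

lemma wce_sobol_le:
  fixes \<gamma> :: "nat set \<Rightarrow> real"
  assumes "1 \<le> m"
    and ab: "\<And>i. 1 \<le> i \<Longrightarrow> a i < b i"
    and dens: "\<And>i. 1 \<le> i \<Longrightarrow> prob_density_on (a i) (b i) (\<phi> i)"
    and bij: "\<And>i. 1 \<le> i \<Longrightarrow> bij_betw (distr_fun (a i) (\<phi> i)) {a i..b i} {0..1}"
    and \<gamma>: "\<And>u. finite u \<Longrightarrow> u \<subseteq> {1..} \<Longrightarrow> 0 < \<gamma> u"
    and quality: "sobol_quality_constant \<mu> c"
    and bound: "\<And>f. (\<And>u. u \<subseteq> {1..s} \<Longrightarrow> 0 \<le> f u) \<Longrightarrow> lp_sum p (Pow {1..s}) f \<le> 1 \<Longrightarrow>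
      3 / 2 ^ m * (\<Sum>u\<in>Pow {1..s} - {{}}. f u *
        (\<gamma> u * (\<Prod>i\<in>u. 2 powr (c + 1) * real m * sobol_weight i * (b i - a i)))) \<le> R"
  shows "wce (2 ^ m) (digital_net m s (sobol_matrix \<mu>)) p s \<gamma> a b \<phi> \<le> ereal R"
  unfolding wce_def
proof (rule SUP_least)
  interpret box_densities s a b \<phi>
    by unfold_locales (use ab dens bij in auto)
  fix F assume "F \<in> {F. mixed_derivs_exist s a b F \<and> weighted_norm p s \<gamma> a b F \<le> 1}"
  then have F: "mixed_derivs_exist s a b F" and norm: "weighted_norm p s \<gamma> a b F \<le> 1" by auto
  define S where "S u = (SUP x\<in>coord_box s a b. \<bar>mixed_deriv a b u F x\<bar>)" for u
  define f where "f u = 1 / \<gamma> u * S u" for u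
  have bdd: "\<forall>u\<subseteq>{1..s}. bdd_above ((\<lambda>x. \<bar>mixed_deriv a b u F x\<bar>) ` coord_box s a b)"
    using norm unfolding weighted_norm_def by (auto split: if_splits)
  then have f: "lp_sum p (Pow {1..s}) f \<le> 1"
    using norm unfolding weighted_norm_def f_def[abs_def] S_def by (simp add: one_ereal_def)
  have S: "\<forall>u\<subseteq>{1..s}. \<forall>x\<in>coord_box s a b. \<bar>mixed_deriv a b u F x\<bar> \<le> S u"
    unfolding S_def using bdd by (auto intro!: cSUP_upper)
  \<comment> \<open>A point of the box is needed to conclude that the suprema \<open>S u\<close> are
    non-negative.\<close>
  have "a i \<in> {a i..b i}" if "i \<in> {1..s}" for i using ab[of i] that by simp
  then have corner: "(\<lambda>i\<in>{1..s}. a i) \<in> coord_box s a b"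
    by (simp add: coord_box_def)
  have \<gamma>_pos: "0 < \<gamma> u" if "u \<subseteq> {1..s}" for u
    using that by (intro \<gamma>) (auto intro: finite_subset)
  have f_nonneg: "0 \<le> f u" if "u \<subseteq> {1..s}" for u
  proof -
    have "0 \<le> S u" by (rule order_trans[OF abs_ge_zero S[rule_format, OF that corner]])
    then show ?thesis using \<gamma>_pos[OF that] by (simp add: f_def)
  qed
  let ?y = "digital_net m s (sobol_matrix \<mu>)"
  have y: "?y n i \<in> {0..1}" if "i \<in> {1..s}" for n i
    using net_int_less[of m "sobol_matrix \<mu>" n i] that
    by (subst digital_net_eq) (auto simp: divide_le_eq less_imp_le)
  have "\<bar>1 / real (2 ^ m) * (\<Sum>n<2 ^ m. F (inv_distr s a b \<phi> (?y n)))
      - (LINT x:coord_box s a b|PiM {1..s} (\<lambda>_. lebesgue). F x * prod_density s \<phi> x)\<bar>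
    \<le> (\<Sum>u\<in>Pow {1..s} - {{}}. S u * (\<Prod>i\<in>u. b i - a i) *
        (3 / 2 ^ m * (\<Prod>i\<in>u. 2 powr (c + 1) * real m * sobol_weight i)))"
  proof (rule koksma_hlawka[OF F S])
    show "(0 :: nat) < 2 ^ m" by simp
    show "?y n i \<in> {0..1}" if "i \<in> {1..s}" for n i using that by (rule y)
    show "\<bar>real (card {n\<in>{..<2 ^ m}. \<forall>i\<in>u. ?y n i < z i}) / real (2 ^ m) - (\<Prod>i\<in>u. z i)\<bar>
        \<le> 3 / 2 ^ m * (\<Prod>i\<in>u. 2 powr (c + 1) * real m * sobol_weight i)"
      if "u \<subseteq> {1..s}" "u \<noteq> {}" "\<And>i. i \<in> u \<Longrightarrow> z i \<in> {0..1}" for u z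
      using sobol_net_discrepancy[OF quality \<open>1 \<le> m\<close> that] .
  qed
  also have "\<dots> = (\<Sum>u\<in>Pow {1..s} - {{}}. 3 / 2 ^ m * (f u *
      (\<gamma> u * (\<Prod>i\<in>u. 2 powr (c + 1) * real m * sobol_weight i * (b i - a i)))))"
  proof (rule sum.cong[OF refl])
    fix u assume "u \<in> Pow {1..s} - {{}}"
    then have "0 < \<gamma> u" by (intro \<gamma>_pos) auto
    then have S_eq: "S u = f u * \<gamma> u" by (simp add: f_def)
    have prod_eq: "(\<Prod>i\<in>u. 2 powr (c + 1) * real m * sobol_weight i * (b i - a i)) =
        (\<Prod>i\<in>u. 2 powr (c + 1) * real m * sobol_weight i) * (\<Prod>i\<in>u. b i - a i)"
      by (rule prod.distrib)
    show "S u * (\<Prod>i\<in>u. b i - a i) * (3 / 2 ^ m * (\<Prod>i\<in>u. 2 powr (c + 1) * real m * sobol_weight i)) =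
        3 / 2 ^ m * (f u * (\<gamma> u * (\<Prod>i\<in>u. 2 powr (c + 1) * real m * sobol_weight i * (b i - a i))))"
      unfolding S_eq prod_eq by (simp only: mult_ac)
  qed
  also have "\<dots> \<le> R"
    unfolding sum_distrib_left[symmetric] by (rule bound[OF f_nonneg f])
  finally show "ereal \<bar>1 / real (2 ^ m) * (\<Sum>n<2 ^ m. F (inv_distr s a b \<phi> (?y n)))
      - (LINT x:coord_box s a b|PiM {1..s} (\<lambda>_. lebesgue). F x * prod_density s \<phi> x)\<bar> \<le> ereal R"
    by (simp only: ereal_less_eq)
qed

lemma inverse_two_power_eq: "3 / 2 ^ m * (x * 2 powr (\<delta> * real m)) = 3 * x / 2 powr (real m * (1 - \<delta>))"
proof -
  have "(2 :: real) ^ m = 2 powr (real m * (1 - \<delta>)) * 2 powr (\<delta> * real m)"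
    by (simp add: powr_add[symmetric] powr_realpow[symmetric] algebra_simps)
  then show ?thesis by (simp only: times_divide_eq_left times_divide_eq_right) simp
qed

theorem theorem7:
  fixes p q :: ereal
    and m s :: nat
    and a b :: "nat \<Rightarrow> real"
    and \<phi> :: "nat \<Rightarrow> real \<Rightarrow> real"
    and \<gamma> :: "nat set \<Rightarrow> real"
    and P :: "nat \<Rightarrow> bit poly"
    and \<mu> :: "nat \<Rightarrow> nat \<Rightarrow> nat"
    and c :: real
  assumes "1 \<le> p" and "1 \<le> q" and "1 / p + 1 / q = 1"
    and "1 \<le> m" and "1 \<le> s"
    and "\<And>i. 1 \<le> i \<Longrightarrow> a i < b i"
    and "\<And>i. 1 \<le> i \<Longrightarrow> prob_density_on (a i) (b i) (\<phi> i)"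
    and "\<And>i. 1 \<le> i \<Longrightarrow> bij_betw (distr_fun (a i) (\<phi> i)) {a i..b i} {0..1}"
    and "\<And>u. finite u \<Longrightarrow> u \<subseteq> {1..} \<Longrightarrow> 0 < \<gamma> u"
    and "primitive_enumeration P"
    and "direction_numbers P \<mu>"
    and "sobol_quality_constant \<mu> c"
  shows "(\<forall>\<delta>. 0 < \<delta> \<and> \<delta> < 1 \<and> C_Sob c \<delta> \<gamma> q a b < \<infinity> \<longrightarrow>
            wce (2 ^ m) (digital_net m s (sobol_matrix \<mu>)) p s \<gamma> a b \<phi>
              \<le> 3 * C_Sob c \<delta> \<gamma> q a b / ereal (2 powr (real m * (1 - \<delta>)))) \<and>
         (summable (\<lambda>i. S_Sob_term \<gamma> a b (i + 1)) \<longrightarrow>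
            (\<forall>\<delta> B. 0 < \<delta> \<and> \<delta> < min 1 (2 powr (c + 2) * S_Sob \<gamma> a b / ln 2) \<and>
                S_Sob_tail \<gamma> a b B < \<delta> * ln 2 / 2 powr (c + 2) \<longrightarrow>
              wce (2 ^ m) (digital_net m s (sobol_matrix \<mu>)) p s \<gamma> a b \<phi>
                \<le> ereal (C_Sob_prod c \<delta> \<gamma> a b B / 2 powr (real m * (1 - \<delta>)))))"
proof (intro conjI allI impI)
  let ?wce = "wce (2 ^ m) (digital_net m s (sobol_matrix \<mu>)) p s \<gamma> a b \<phi>"
  note wce_le = wce_sobol_le[OF assms(4,6-9,12)]
  \<comment> \<open>The factor of \<open>f u\<close> in the error bound, up to the common
    \<open>3 / 2 ^ m\<close>.\<close>
  define e where "e u = \<gamma> u * (\<Prod>i\<in>u. 2 powr (c + 1) * real m * sobol_weight i * (b i - a i))" for u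
  have fin: "finite u" "u \<subseteq> {1..}" if "u \<subseteq> {1..s}" for u
    using that finite_subset by auto
  {
    fix \<delta> assume "0 < \<delta> \<and> \<delta> < 1 \<and> C_Sob c \<delta> \<gamma> q a b < \<infinity>"
    then have "0 < \<delta>" and finite: "C_Sob c \<delta> \<gamma> q a b < \<infinity>" by auto
    define g where "g u = \<gamma> u * (\<Prod>i\<in>u. 2 powr (c + 1) * real (card u) * real i / (exp 1 * \<delta> * ln 2)
        * ld (real i + 1) * ld (ld (real i + 3)) * (b i - a i))" for u
    define L where "L = lp_sum q (Pow {1..s} - {{}}) g"
    have w: "0 \<le> 2 powr (c + 1) * sobol_weight i * (b i - a i)" if "i \<in> {1..s}" for i
      using that sobol_weight_pos[of i] assms(6)[of i] by simp
    have g_eq: "g u = (real (card u) / (exp 1 * (\<delta> * ln 2))) ^ card u *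
        (\<gamma> u * (\<Prod>i\<in>u. 2 powr (c + 1) * sobol_weight i * (b i - a i)))" for u
    proof -
      have "(\<Prod>i\<in>u. 2 powr (c + 1) * real (card u) * real i / (exp 1 * \<delta> * ln 2)
          * ld (real i + 1) * ld (ld (real i + 3)) * (b i - a i)) =
          (\<Prod>i\<in>u. real (card u) / (exp 1 * (\<delta> * ln 2)) * (2 powr (c + 1) * sobol_weight i * (b i - a i)))"
        by (intro prod.cong refl) (simp add: sobol_weight_def mult_ac)
      also have "\<dots> = (real (card u) / (exp 1 * (\<delta> * ln 2))) ^ card u *
          (\<Prod>i\<in>u. 2 powr (c + 1) * sobol_weight i * (b i - a i))"
        by (simp only: prod.distrib[where g = "\<lambda>_. real (card u) / (exp 1 * (\<delta> * ln 2))"] prod_constant)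
      finally show ?thesis by (simp only: g_def mult.left_commute)
    qed
    have nn: "0 \<le> \<gamma> u * (\<Prod>i\<in>u. 2 powr (c + 1) * sobol_weight i * (b i - a i))" if "u \<subseteq> {1..s}" for u
      using assms(9)[OF fin[OF that]] that by (intro mult_nonneg_nonneg prod_nonneg w) auto
    have g_nonneg: "0 \<le> g u" if "u \<subseteq> {1..s}" for u
      unfolding g_eq using \<open>0 < \<delta>\<close> by (intro mult_nonneg_nonneg[OF _ nn[OF that]]) simp
    have e_le: "e u \<le> g u * 2 powr (\<delta> * real m)" if u: "u \<subseteq> {1..s}" "u \<noteq> {}" for u
    proof -
      have "0 < card u" using u fin[OF u(1)] by (simp add: card_gt_0_iff)
      \<comment> \<open>Trades the power of \<open>m\<close> for 2^(\<delta> m):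
        \<open>power_le_exp\<close> at the rate \<delta> ln 2, whose quotient k / (e \<delta> ln 2)
        is the one occurring in \<open>C_Sob\<close>.\<close>
      then have "real m ^ card u \<le> (real (card u) / (exp 1 * (\<delta> * ln 2))) ^ card u * exp (\<delta> * ln 2 * real m)"
        using \<open>0 < \<delta>\<close> by (intro power_le_exp) auto
      also have "exp (\<delta> * ln 2 * real m) = 2 powr (\<delta> * real m)"
        by (simp add: powr_def mult_ac)
      finally have le: "real m ^ card u \<le> (real (card u) / (exp 1 * (\<delta> * ln 2))) ^ card u * 2 powr (\<delta> * real m)" .
      have "(\<Prod>i\<in>u. 2 powr (c + 1) * real m * sobol_weight i * (b i - a i)) =
          (\<Prod>i\<in>u. real m * (2 powr (c + 1) * sobol_weight i * (b i - a i)))"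
        by (intro prod.cong refl) (simp only: mult_ac)
      also have "\<dots> = real m ^ card u * (\<Prod>i\<in>u. 2 powr (c + 1) * sobol_weight i * (b i - a i))"
        by (simp only: prod.distrib[where g = "\<lambda>_. real m"] prod_constant)
      finally have "e u = real m ^ card u * (\<gamma> u * (\<Prod>i\<in>u. 2 powr (c + 1) * sobol_weight i * (b i - a i)))"
        by (simp only: e_def mult.left_commute)
      also have "\<dots> \<le> (real (card u) / (exp 1 * (\<delta> * ln 2))) ^ card u * 2 powr (\<delta> * real m) *
          (\<gamma> u * (\<Prod>i\<in>u. 2 powr (c + 1) * sobol_weight i * (b i - a i)))"
        by (rule mult_right_mono[OF le nn[OF u(1)]])
      also have "\<dots> = g u * 2 powr (\<delta> * real m)"
        unfolding g_eq by (simp only: mult_ac)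
      finally show ?thesis .
    qed
    have "?wce \<le> ereal (3 * L / 2 powr (real m * (1 - \<delta>)))"
    proof (rule wce_le, fold e_def)
      fix f assume f: "\<And>u. u \<subseteq> {1..s} \<Longrightarrow> 0 \<le> f u" and norm: "lp_sum p (Pow {1..s}) f \<le> 1"
      \<comment> \<open>For infinite \<open>q\<close>, \<open>lp_sum\<close> is a maximum, so the
        index set has to be non-empty.\<close>
      have "{1} \<in> Pow {1..s} - {{}}" using \<open>1 \<le> s\<close> by auto
      then have ne: "Pow {1..s} - {{}} \<noteq> {}" by blast
      have "(\<Sum>u\<in>Pow {1..s} - {{}}. f u * e u) \<le> (\<Sum>u\<in>Pow {1..s} - {{}}. f u * (g u * 2 powr (\<delta> * real m)))"
        by (intro sum_mono mult_left_mono e_le f) auto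
      also have "\<dots> = (\<Sum>u\<in>Pow {1..s} - {{}}. f u * g u) * 2 powr (\<delta> * real m)"
        by (simp only: sum_distrib_right mult.assoc)
      also have "\<dots> \<le> L * 2 powr (\<delta> * real m)"
      proof (rule mult_right_mono)
        show "(\<Sum>u\<in>Pow {1..s} - {{}}. f u * g u) \<le> L"
          unfolding L_def
        proof (rule holder_lp_sum[OF assms(1-3) _ _ ne _ _ norm])
          show "0 \<le> f u" if "u \<in> Pow {1..s}" for u using that by (intro f) simp
          show "0 \<le> g u" if "u \<in> Pow {1..s} - {{}}" for u using that by (intro g_nonneg) simp
        qed auto
      qed simp
      finally have "3 / 2 ^ m * (\<Sum>u\<in>Pow {1..s} - {{}}. f u * e u) \<le> 3 / 2 ^ m * (L * 2 powr (\<delta> * real m))"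
        by (intro mult_left_mono) auto
      then show "3 / 2 ^ m * (\<Sum>u\<in>Pow {1..s} - {{}}. f u * e u) \<le> 3 * L / 2 powr (real m * (1 - \<delta>))"
        by (simp only: inverse_two_power_eq)
    qed
    also have "\<dots> \<le> 3 * C_Sob c \<delta> \<gamma> q a b / ereal (2 powr (real m * (1 - \<delta>)))"
    proof -
      \<comment> \<open>\<open>L\<close> is the entry for dimension \<open>s\<close> in the
        supremum. It also excludes the value minus infinity, so with \<open>finite\<close> the
        supremum is a real number.\<close>
      have "ereal L \<le> C_Sob c \<delta> \<gamma> q a b"
        unfolding C_Sob_def L_def g_def[abs_def] using \<open>1 \<le> s\<close> by (intro SUP_upper) auto
      then obtain C where C: "C_Sob c \<delta> \<gamma> q a b = ereal C" "L \<le> C"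
        using finite by (cases "C_Sob c \<delta> \<gamma> q a b") auto
      have "3 * C_Sob c \<delta> \<gamma> q a b / ereal (2 powr (real m * (1 - \<delta>))) =
          ereal (3 * C / 2 powr (real m * (1 - \<delta>)))"
        by (simp add: C(1))
      then show ?thesis using C(2) by (simp add: divide_right_mono)
    qed
    finally show "?wce \<le> 3 * C_Sob c \<delta> \<gamma> q a b / ereal (2 powr (real m * (1 - \<delta>)))" .
  }
  {
    fix \<delta> B
    assume summable: "summable (\<lambda>i. S_Sob_term \<gamma> a b (i + 1))"
      and "0 < \<delta> \<and> \<delta> < min 1 (2 powr (c + 2) * S_Sob \<gamma> a b / ln 2) \<and>
        S_Sob_tail \<gamma> a b B < \<delta> * ln 2 / 2 powr (c + 2)"
    then have \<delta>: "0 < \<delta>" "\<delta> < 2 powr (c + 2) * S_Sob \<gamma> a b / ln 2"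
      and tail: "S_Sob_tail \<gamma> a b B < \<delta> * ln 2 / 2 powr (c + 2)" by auto
    define M where "M i = (MAX v\<in>Pow {1..<i}. (\<gamma>({} := 1)) (insert i v) / (\<gamma>({} := 1)) v)" for i
    define y where "y i = 2 powr (c + 1) * S_Sob_term \<gamma> a b i" for i
    \<comment> \<open>Half of \<delta> ln 2, since the two blocks of coordinates contribute
      exp(\<epsilon> m) each and 2^(\<delta> m) together. This halving turns c + 1 into the c + 2 of
      the constant.\<close>
    define \<epsilon> where "\<epsilon> = \<delta> * ln 2 / 2"
    have two: "2 powr (c + 2) = 2 * 2 powr (c + 1)"
      using powr_add[of 2 "c + 1" 1] by (simp add: ac_simps)
    have "0 < \<epsilon>" using \<delta>(1) by (simp add: \<epsilon>_def)
    have term_eq: "S_Sob_term \<gamma> a b i = sobol_weight i * (b i - a i) * M i" for i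
      by (simp add: S_Sob_term_def sobol_weight_def M_def)
    \<comment> \<open>The maximum includes the ratio for the empty set, which is
      \<open>\<gamma> {i}\<close>.\<close>
    have "0 \<le> M i" if "1 \<le> i" for i
    proof -
      have "0 < (\<gamma>({} := 1)) (insert i {}) / (\<gamma>({} := 1)) {}"
        using assms(9)[of "{i}"] that by simp
      also have "\<dots> \<le> M i" unfolding M_def by (intro Max_ge) auto
      finally show ?thesis by simp
    qed
    then have y_nonneg: "0 \<le> y i" if "1 \<le> i" for i
      using that sobol_weight_pos[OF that] assms(6)[OF that] by (simp add: y_def term_eq)
    have y_summable: "summable (\<lambda>i. y (i + 1))"
      unfolding y_def by (rule summable_mult[OF summable])
    have Y: "(\<Sum>i. y (i + 1)) = 2 powr (c + 1) * S_Sob \<gamma> a b"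
      unfolding y_def S_Sob_def by (rule suminf_mult[OF summable])
    have "summable (\<lambda>i. S_Sob_term \<gamma> a b (i + B + 1))"
      using summable_ignore_initial_segment[OF summable, of B] by simp
    then have "(\<Sum>i. y (i + B + 1)) = 2 powr (c + 1) * S_Sob_tail \<gamma> a b B"
      unfolding y_def S_Sob_tail_def by (rule suminf_mult)
    also have "\<dots> \<le> \<epsilon>"
    proof -
      have "S_Sob_tail \<gamma> a b B * (2 * 2 powr (c + 1)) < \<delta> * ln 2"
        using tail unfolding two by (subst (asm) pos_less_divide_eq) simp_all
      moreover have "S_Sob_tail \<gamma> a b B * (2 * 2 powr (c + 1)) = 2 * (2 powr (c + 1) * S_Sob_tail \<gamma> a b B)"
        by simp
      ultimately show ?thesis unfolding \<epsilon>_def by linarith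
    qed
    finally have y_tail: "(\<Sum>i. y (i + B + 1)) \<le> \<epsilon>" .
    have K: "(\<Sum>i. y (i + 1)) / \<epsilon> = 2 powr (c + 2) * S_Sob \<gamma> a b / (\<delta> * ln 2)"
      unfolding Y by (simp add: \<epsilon>_def two)
    \<comment> \<open>Here the upper bound on \<delta> enters: it makes the base of the power in
      \<open>C_Sob_prod\<close> at least 1.\<close>
    have "\<delta> * ln 2 < 2 powr (c + 2) * S_Sob \<gamma> a b" using \<delta>(2) by (simp add: less_divide_eq)
    then have K_ge: "1 \<le> (\<Sum>i. y (i + 1)) / \<epsilon>"
      unfolding K using \<delta>(1) by (simp add: le_divide_eq)
    have "(\<Prod>i=1..s. 1 + real m * y i) \<le> ((\<Sum>i. y (i + 1)) / \<epsilon>) ^ B * exp (2 * \<epsilon> * real m)"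
      using y_nonneg
      by (rule prod_one_plus_le_power_mult_exp[OF _ y_summable \<open>0 < \<epsilon>\<close> of_nat_0_le_iff K_ge y_tail])
    also have "exp (2 * \<epsilon> * real m) = 2 powr (\<delta> * real m)"
      by (simp add: powr_def \<epsilon>_def)
    finally have prod_le: "(\<Prod>i=1..s. 1 + real m * y i) \<le>
        (2 powr (c + 2) * S_Sob \<gamma> a b / (\<delta> * ln 2)) ^ B * 2 powr (\<delta> * real m)"
      unfolding K .
    show "?wce \<le> ereal (C_Sob_prod c \<delta> \<gamma> a b B / 2 powr (real m * (1 - \<delta>)))"
    proof (rule wce_le, fold e_def)
      fix f assume f: "\<And>u. u \<subseteq> {1..s} \<Longrightarrow> 0 \<le> f u" and norm: "lp_sum p (Pow {1..s}) f \<le> 1"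
      have z: "0 \<le> 2 powr (c + 1) * real m * sobol_weight i * (b i - a i)" if "1 \<le> i" for i
        using sobol_weight_pos[OF that] assms(6)[OF that] by simp
      \<comment> \<open>The norm is exploited through \<open>f u \<le> 1\<close> alone, so the bound
        is the same for every \<open>p\<close>.\<close>
      have "(\<Sum>u\<in>Pow {1..s} - {{}}. f u * e u) \<le> (\<Sum>u\<in>Pow {1..s} - {{}}. 1 * e u)"
      proof (intro sum_mono mult_right_mono)
        fix u assume "u \<in> Pow {1..s} - {{}}"
        then have u: "u \<subseteq> {1..s}" by simp
        show "f u \<le> 1"
        proof (rule lp_sum_le_1_imp_le_1[OF assms(1-3) _ _ norm])
          show "0 \<le> f u" if "u \<in> Pow {1..s}" for u using that by (intro f) simp
          show "u \<in> Pow {1..s}" using u by simp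
        qed simp
        have "\<And>i. i \<in> u \<Longrightarrow> 1 \<le> i" using u by auto
        then show "0 \<le> e u"
          unfolding e_def using assms(9)[OF fin[OF u]]
          by (intro mult_nonneg_nonneg prod_nonneg z) auto
      qed
      also have "\<dots> = (\<Sum>u\<in>Pow {1..s} - {{}}. e u)" by simp
      also have "\<dots> \<le> (\<Prod>i=1..s. 1 + 2 powr (c + 1) * real m * sobol_weight i * (b i - a i) * M i)"
        unfolding e_def M_def by (rule sum_weighted_prod_le[OF assms(9) z])
      also have "\<dots> = (\<Prod>i=1..s. 1 + real m * y i)"
        by (intro prod.cong refl) (simp add: y_def term_eq)
      also note prod_le
      finally have "3 / 2 ^ m * (\<Sum>u\<in>Pow {1..s} - {{}}. f u * e u) \<le>
          3 / 2 ^ m * ((2 powr (c + 2) * S_Sob \<gamma> a b / (\<delta> * ln 2)) ^ B * 2 powr (\<delta> * real m))"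
        by (intro mult_left_mono) auto
      then show "3 / 2 ^ m * (\<Sum>u\<in>Pow {1..s} - {{}}. f u * e u) \<le>
          C_Sob_prod c \<delta> \<gamma> a b B / 2 powr (real m * (1 - \<delta>))"
        by (simp only: inverse_two_power_eq C_Sob_prod_def)
    qed
  }
qed

end
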